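(* Let $n=3$, let $v_\infty\in\mathbb{R}^{4,1}$ be non-zero, and suppose $\Lambda$ has constant mean curvature $H_\infty$ in $S_{v_\infty}$. Let $t\in\mathbb{R}$, $\lambda\in S^1$, and let $\phi^\lambda_{q_\infty^t}:(\underline{\mathbb{R}}^{4,1},d^{\lambda,q_\infty^t}_S)\to(\underline{\mathbb{R}}^{4,1},d)$ be an isomorphism of bundles with metric and connection. Set $$v^\lambda_{q_\infty^t}:=\phi^\lambda_{q_\infty^t}\Big(v_\infty^T+\big((\mathrm{Re}\,\lambda)H_\infty+\tfrac{it}{2}(\lambda-\lambda^{-1})\big)N\Big),$$ which is a non-zero constant section of $\underline{\mathbb{R}}^{4,1}$. Then the spectral deformation $\phi^\lambda_{q_\infty^t}\Lambda$ of $\Lambda$ of parameter $\lambda$ corresponding to the multiplier $q_\infty^t$ is a CMC surface in $S_{v^\lambda_{q_\infty^t}}$.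
   Context: $\mathbb{R}^{4,1}$ has metric $(\,,\,)$ of signature $(4,1)$, extended complex bilinearly to $\mathbb{C}^{5}$; $\mathcal{L}$ is the set of non-zero null vectors of $\mathbb{R}^{4,1}$; $M$ is an oriented surface; $\underline{\mathbb{R}}^{4,1}=M\times\mathbb{R}^{4,1}$ with trivial flat connection $d$. The theory is local: restriction to a suitable non-empty open subset of $M$ is always understood. $\wedge^{2}\mathbb{R}^{4,1}\cong o(\mathbb{R}^{4,1})$ by $(v_1\wedge v_2)(w)=(w,v_1)v_2-(w,v_2)v_1$; $[\mu\wedge\eta](X,Y)=[\mu_X,\eta_Y]-[\mu_Y,\eta_X]$; $d^\nabla$ is the exterior derivative on endomorphism-valued forms. A surface is a null line subbundle $\Lambda\subset\underline{\mathbb{R}}^{4,1}$ defining an immersion $M\to\mathbb{P}(\mathcal{L})\cong S^3$ (standing assumption: not contained in any $2$-sphere of $S^3$). $M$ carries the conformal structure of the metrics $g_\sigma(X,Y)=(d_X\sigma,d_Y\sigma)$, $\sigma\in\Gamma(\Lambda)$ never-zero; $(1,0)$/$(0,1)$-parts and $*$ (with $*\omega=-\omega\circ J$) refer to it. For a holomorphic chart $z$, $\Lambda^{(1)}=\langle\sigma,\sigma_z,\sigma_{\bar z}\rangle$ and the central sphere congruence is (complexified) $S=\langle\sigma,\sigma_z,\sigma_{\bar z},\sigma_{z\bar z}\rangle$. $\mathcal{D}:=\pi_S\circ d\circ\pi_S+\pi_{S^\perp}\circ d\circ\pi_{S^\perp}$, $\mathcal{N}:=d-\mathcal{D}$. A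 real $q\in\Omega^1(\Lambda\wedge\Lambda^{(1)})$ is a multiplier if $d^{\mathcal{D}}q=0$ and $d^{\mathcal{D}}*\mathcal{N}=2[q\wedge*\mathcal{N}]$. Set $d^{\lambda,q}_S:=\mathcal{D}+\lambda^{-1}\mathcal{N}^{1,0}+\lambda\mathcal{N}^{0,1}+(\lambda^{-2}-1)q^{1,0}+(\lambda^2-1)q^{0,1}$, which for $q$ a multiplier is flat and metric, and for $\lambda\in S^1$ real. The spectral deformation of $\Lambda$ of parameter $\lambda\in S^1$ corresponding to $q$ is the surface $\phi\Lambda$, for $\phi$ an isometry of $\underline{\mathbb{R}}^{4,1}$ with $\phi\circ d^{\lambda,q}_S=d\circ\phi$. For non-zero $v_\infty\in\mathbb{R}^{4,1}$, $S_{v_\infty}=\{v\in\mathcal{L}:(v,v_\infty)=-1\}$, $\sigma_\infty:=-\sigma/(\sigma,v_\infty)$, and $v_\infty^T,v_\infty^\perp$ are the orthogonal projections of $v_\infty$ onto $S$ and $S^\perp$. The mean curvature of $\Lambda$ in $S_{v_\infty}$ is $H_\infty:=(v_\infty^\perp,v_\infty^\perp)^{1/2}$; $\Lambda$ is CMC in $S_{v_\infty}$ if this is constant. $N$ is the real unit section of $S^\perp$ with $v_\infty^\perp=H_\infty N$ (if $H_\infty=0$, one of the two choices of sign is fixed). For $\Lambda$ CMC in $S_{v_\infty}$: $\eta_\infty:=\frac12\sigma_\infty\wedge dN$, $q_\infty:=H_\infty\eta_\infty$ and $q_\infty^t:=q_\infty+t*\eta_\infty$ ($t\in\mathbb{R}$),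 which are multipliers to $\Lambda$. *)

theory Defs
  imports "HOL-Analysis.Analysis"
begin

section \<open>Smooth functions of one complex variable and oriented surfaces\<close>

text \<open>\<open>d\<^sub>X f\<close> for a real tangent vector \<open>X\<close> of an open subset of the plane;
  tangent vectors of the plane are written as complex numbers, so that \<open>J X = \<i> X\<close> in a
  holomorphic chart.\<close>

definition dd :: "complex \<Rightarrow> (complex \<Rightarrow> 'b::real_normed_vector) \<Rightarrow> complex \<Rightarrow> 'b" where
  "dd X f w = frechet_derivative f (at w) X"

primrec Ck_on :: "nat \<Rightarrow> complex set \<Rightarrow> (complex \<Rightarrow> 'b::real_normed_vector) \<Rightarrow> bool" where
  "Ck_on 0 V f \<longleftrightarrow> continuous_on V f"
| "Ck_on (Suc k) V f \<longleftrightarrow> f differentiable_on V \<and> (\<forall>X. Ck_on k V (dd X f))"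

text \<open>Only used for open \<open>V\<close>.\<close>

definition smooth_on :: "complex set \<Rightarrow> (complex \<Rightarrow> 'b::real_normed_vector) \<Rightarrow> bool" where
  "smooth_on V f \<longleftrightarrow> (\<forall>k. Ck_on k V f)"

type_synonym 'm chart = "'m set \<times> ('m \<Rightarrow> complex)"

definition chart_image :: "'m chart \<Rightarrow> complex set" where
  "chart_image c = snd c ` fst c"

definition in_chart :: "'m chart \<Rightarrow> ('m \<Rightarrow> 'a) \<Rightarrow> complex \<Rightarrow> 'a" where
  "in_chart c f = (\<lambda>w. f (inv_into (fst c) (snd c) w))"

definition is_chart :: "'m topology \<Rightarrow> 'm chart \<Rightarrow> bool" where
  "is_chart M c \<longleftrightarrow> openin M (fst c) \<and> open (chart_image c) \<and>
     homeomorphic_map (subtopology M (fst c)) (top_of_set (chart_image c)) (snd c)"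

text \<open>The number \<open>Im (cnj (d\<^sub>1 T) * d\<^sub>\<i> T)\<close> is the Jacobian determinant of \<open>T\<close>.\<close>

definition oriented_compatible :: "'m chart \<Rightarrow> 'm chart \<Rightarrow> bool" where
  "oriented_compatible c c' \<longleftrightarrow>
     (let T = in_chart c (snd c'); V = snd c ` (fst c \<inter> fst c') in
        smooth_on V T \<and> (\<forall>w\<in>V. Im (cnj (dd 1 T w) * dd \<i> T w) > 0))"

definition oriented_surface :: "'m topology \<Rightarrow> 'm chart set \<Rightarrow> bool" where
  "oriented_surface M \<A> \<longleftrightarrow>
     Hausdorff_space M \<and> second_countable M \<and> connected_space M \<and> topspace M \<noteq> {} \<and>
     (\<forall>c\<in>\<A>. is_chart M c) \<and> (\<Union>c\<in>\<A>. fst c) = topspace M \<and>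
     (\<forall>c\<in>\<A>. \<forall>c'\<in>\<A>. oriented_compatible c c')"

definition smooth_map :: "'m chart set \<Rightarrow> ('m \<Rightarrow> 'b::real_normed_vector) \<Rightarrow> bool" where
  "smooth_map \<A> f \<longleftrightarrow> (\<forall>c\<in>\<A>. smooth_on (chart_image c) (in_chart c f))"


section \<open>Minkowski space and its complexification\<close>

text \<open>The metric of signature (4,1) on \<open>real^5\<close>, and at type \<open>complex^5\<close> its complex bilinear
  (not Hermitian) extension. Coordinate 0 is the timelike one.\<close>

definition lform :: "'a::comm_ring_1 ^ 5 \<Rightarrow> 'a ^ 5 \<Rightarrow> 'a" where
  "lform x y = (\<Sum>i\<in>UNIV. (if i = 0 then - 1 else 1) * (x $ i * y $ i))"

definition lightcone :: "(real ^ 5) set" where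
  "lightcone = {v. v \<noteq> 0 \<and> lform v v = 0}"

definition cvec :: "real ^ 5 \<Rightarrow> complex ^ 5" where
  "cvec v = (\<chi> i. complex_of_real (v $ i))"

definition cmat :: "real ^ 5 ^ 5 \<Rightarrow> complex ^ 5 ^ 5" where
  "cmat A = (\<chi> i j. complex_of_real (A $ i $ j))"

definition is_isometry :: "real ^ 5 ^ 5 \<Rightarrow> bool" where
  "is_isometry A \<longleftrightarrow> (\<forall>x y. lform (A *v x) (A *v y) = lform x y)"

definition wedge :: "complex ^ 5 \<Rightarrow> complex ^ 5 \<Rightarrow> complex ^ 5 \<Rightarrow> complex ^ 5" where
  "wedge v1 v2 w = lform w v1 *s v2 - lform w v2 *s v1"

definition perp :: "(complex ^ 5) set \<Rightarrow> (complex ^ 5) set" where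
  "perp W = {x. \<forall>y\<in>W. lform x y = 0}"

text \<open>Orthogonal projection; meaningful when \<open>W\<close> is non-degenerate.\<close>

definition oproj :: "(complex ^ 5) set \<Rightarrow> complex ^ 5 \<Rightarrow> complex ^ 5" where
  "oproj W v = (THE x. x \<in> W \<and> v - x \<in> perp W)"


section \<open>Surfaces in the conformal 3-sphere\<close>

text \<open>From here on, \<open>\<Lambda>\<close> is either a family of lines over the surface, or its expression
  \<^term>\<open>in_chart c \<Lambda>\<close> over the image of a chart.\<close>

definition nz_section :: "complex set \<Rightarrow> (complex \<Rightarrow> (real ^ 5) set) \<Rightarrow> (complex \<Rightarrow> real ^ 5) \<Rightarrow> bool" where
  "nz_section V \<Lambda> s \<longleftrightarrow> open V \<and> smooth_on V s \<and> (\<forall>w\<in>V. s w \<in> \<Lambda> w \<and> s w \<noteq> 0)"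

definition null_line_subbundle :: "complex set \<Rightarrow> (complex \<Rightarrow> (real ^ 5) set) \<Rightarrow> bool" where
  "null_line_subbundle V \<Lambda> \<longleftrightarrow>
     (\<forall>w\<in>V. \<exists>V' s. w \<in> V' \<and> V' \<subseteq> V \<and> nz_section V' \<Lambda> s \<and>
        (\<forall>u\<in>V'. \<Lambda> u = span {s u} \<and> s u \<in> lightcone))"

text \<open>The differential of \<open>\<Lambda>\<close>, as a map into the projectivised light cone, sends \<open>X\<close> to
  the homomorphism \<open>s \<mapsto> d\<^sub>X s mod \<Lambda>\<close>.\<close>

definition immersive :: "complex set \<Rightarrow> (complex \<Rightarrow> (real ^ 5) set) \<Rightarrow> bool" where
  "immersive V \<Lambda> \<longleftrightarrow>
     (\<forall>V' s. V' \<subseteq> V \<longrightarrow> nz_section V' \<Lambda> s \<longrightarrow> (\<forall>w\<in>V'. \<forall>X. X \<noteq> 0 \<longrightarrow> dd X s w \<notin> \<Lambda> w))"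

definition induced_metric :: "(complex \<Rightarrow> real ^ 5) \<Rightarrow> complex \<Rightarrow> complex \<Rightarrow> complex \<Rightarrow> real" where
  "induced_metric s w X Y = lform (dd X s w) (dd Y s w)"

text \<open>The chart is holomorphic for the conformal structure of the metrics \<open>g\<^sub>s\<close> (and the
  orientation of the atlas) iff multiplication by \<open>\<i>\<close> is \<open>g\<^sub>s\<close>-orthogonal.\<close>

definition conformal_coordinate :: "complex set \<Rightarrow> (complex \<Rightarrow> (real ^ 5) set) \<Rightarrow> bool" where
  "conformal_coordinate V \<Lambda> \<longleftrightarrow>
     (\<forall>V' s. V' \<subseteq> V \<longrightarrow> nz_section V' \<Lambda> s \<longrightarrow>
        (\<forall>w\<in>V'. \<forall>X Y. induced_metric s w (\<i> * X) (\<i> * Y) = induced_metric s w X Y))"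

text \<open>A 2-sphere of the conformal 3-sphere is the set of null lines orthogonal to a spacelike
  vector. An oriented surface with a conformal structure is a Riemann surface; the atlas \<open>\<A>\<close> is
  required to consist of holomorphic charts.\<close>

definition conformal_surface :: "'m topology \<Rightarrow> 'm chart set \<Rightarrow> ('m \<Rightarrow> (real ^ 5) set) \<Rightarrow> bool" where
  "conformal_surface M \<A> \<Lambda> \<longleftrightarrow>
     oriented_surface M \<A> \<and>
     (\<forall>c\<in>\<A>. null_line_subbundle (chart_image c) (in_chart c \<Lambda>) \<and>
        immersive (chart_image c) (in_chart c \<Lambda>) \<and>
        conformal_coordinate (chart_image c) (in_chart c \<Lambda>)) \<and>
     \<not> (\<exists>n. lform n n > 0 \<and> (\<forall>p\<in>topspace M. \<forall>x\<in>\<Lambda> p. lform x n = 0))"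

definition dz :: "(complex \<Rightarrow> complex ^ 5) \<Rightarrow> complex \<Rightarrow> complex ^ 5" where
  "dz f w = (1 / 2) *s (dd 1 f w - \<i> *s dd \<i> f w)"

definition dzbar :: "(complex \<Rightarrow> complex ^ 5) \<Rightarrow> complex \<Rightarrow> complex ^ 5" where
  "dzbar f w = (1 / 2) *s (dd 1 f w + \<i> *s dd \<i> f w)"

text \<open>The complexified central sphere congruence, in a holomorphic chart. The span does not depend
  on the local section \<open>s\<close>, so the union over all \<open>s\<close> is that span.\<close>

definition csc :: "(complex \<Rightarrow> (real ^ 5) set) \<Rightarrow> complex \<Rightarrow> (complex ^ 5) set" where
  "csc \<Lambda> w = (\<Union>s \<in> {s. \<exists>V. w \<in> V \<and> nz_section V \<Lambda> s}.
     (let f = (\<lambda>u. cvec (s u)) in vec.span {f w, dz f w, dzbar f w, dzbar (dz f) w}))"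


section \<open>Spectral deformation\<close>

text \<open>Connections and endomorphism-valued 1-forms over a chart are both represented as operators
  taking a tangent vector and a section to a section; for a 1-form the operator is tensorial in
  the section.\<close>

type_synonym opform = "complex \<Rightarrow> (complex \<Rightarrow> complex ^ 5) \<Rightarrow> complex \<Rightarrow> complex ^ 5"

definition part10 :: "opform \<Rightarrow> opform" where
  "part10 \<omega> X f w = (1 / 2) *s (\<omega> X f w - \<i> *s \<omega> (\<i> * X) f w)"

definition part01 :: "opform \<Rightarrow> opform" where
  "part01 \<omega> X f w = (1 / 2) *s (\<omega> X f w + \<i> *s \<omega> (\<i> * X) f w)"

definition star :: "opform \<Rightarrow> opform" where
  "star \<omega> X f w = - \<omega> (\<i> * X) f w"

definition Dconn :: "(complex \<Rightarrow> (complex ^ 5) set) \<Rightarrow> opform" where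
  "Dconn S X f w =
     oproj (S w) (dd X (\<lambda>u. oproj (S u) (f u)) w) +
     oproj (perp (S w)) (dd X (\<lambda>u. oproj (perp (S u)) (f u)) w)"

definition Nform :: "(complex \<Rightarrow> (complex ^ 5) set) \<Rightarrow> opform" where
  "Nform S X f w = dd X f w - Dconn S X f w"

definition spectral_connection :: "(complex \<Rightarrow> (complex ^ 5) set) \<Rightarrow> complex \<Rightarrow> opform \<Rightarrow> opform" where
  "spectral_connection S l q X f w =
     Dconn S X f w + (1 / l) *s part10 (Nform S) X f w + l *s part01 (Nform S) X f w
     + (1 / l\<^sup>2 - 1) *s part10 q X f w + (l\<^sup>2 - 1) *s part01 q X f w"

text \<open>\<open>\<phi>\<close> is an isometric isomorphism of the trivial bundle with \<open>\<phi> \<circ> d\<^sup>l\<^sup>,\<^sup>q = d \<circ> \<phi>\<close> on sections of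
  the real bundle. The argument \<open>q\<close> gives the 1-form in each chart.\<close>

definition spectral_isomorphism ::
  "'m topology \<Rightarrow> 'm chart set \<Rightarrow> ('m \<Rightarrow> (real ^ 5) set) \<Rightarrow> complex \<Rightarrow> ('m chart \<Rightarrow> opform)
   \<Rightarrow> ('m \<Rightarrow> real ^ 5 ^ 5) \<Rightarrow> bool" where
  "spectral_isomorphism M \<A> \<Lambda> l q \<phi> \<longleftrightarrow>
     smooth_map \<A> \<phi> \<and> (\<forall>p\<in>topspace M. is_isometry (\<phi> p)) \<and>
     (\<forall>c\<in>\<A>. \<forall>f :: complex \<Rightarrow> real ^ 5. smooth_on (chart_image c) f \<longrightarrow>
        (\<forall>w\<in>chart_image c. \<forall>X.
           cmat (in_chart c \<phi> w) *v
             spectral_connection (csc (in_chart c \<Lambda>)) l (q c) X (\<lambda>u. cvec (f u)) w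
           = dd X (\<lambda>u. cvec (in_chart c \<phi> u *v f u)) w))"

definition bundle_image :: "('m \<Rightarrow> real ^ 5 ^ 5) \<Rightarrow> ('m \<Rightarrow> (real ^ 5) set) \<Rightarrow> 'm \<Rightarrow> (real ^ 5) set" where
  "bundle_image \<phi> \<Lambda> p = (\<lambda>x. \<phi> p *v x) ` \<Lambda> p"


section \<open>Constant mean curvature surfaces\<close>

definition space_form :: "real ^ 5 \<Rightarrow> (real ^ 5) set" where
  "space_form v = {x \<in> lightcone. lform x v = - 1}"

text \<open>\<open>- \<sigma> / (\<sigma>, v)\<close> for an arbitrary non-zero \<open>\<sigma>\<close> in the line.\<close>

definition sigma_inf :: "('m \<Rightarrow> (real ^ 5) set) \<Rightarrow> real ^ 5 \<Rightarrow> 'm \<Rightarrow> real ^ 5" where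
  "sigma_inf \<Lambda> v p = (let s = (SOME s. s \<in> \<Lambda> p \<and> s \<noteq> 0) in (- 1 / lform s v) *\<^sub>R s)"

definition vtan :: "(complex \<Rightarrow> (real ^ 5) set) \<Rightarrow> real ^ 5 \<Rightarrow> complex \<Rightarrow> complex ^ 5" where
  "vtan \<Lambda> v w = oproj (csc \<Lambda> w) (cvec v)"

definition vperp :: "(complex \<Rightarrow> (real ^ 5) set) \<Rightarrow> real ^ 5 \<Rightarrow> complex \<Rightarrow> complex ^ 5" where
  "vperp \<Lambda> v w = oproj (perp (csc \<Lambda> w)) (cvec v)"

text \<open>\<^term>\<open>vperp \<Lambda> v w\<close> is a real vector, so \<^const>\<open>Re\<close> only changes the type.\<close>

definition mean_curvature :: "(complex \<Rightarrow> (real ^ 5) set) \<Rightarrow> real ^ 5 \<Rightarrow> complex \<Rightarrow> real" where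
  "mean_curvature \<Lambda> v w = sqrt (Re (lform (vperp \<Lambda> v w) (vperp \<Lambda> v w)))"

text \<open>As \<open>1 / 0 = 0\<close>, membership of \<^const>\<open>sigma_inf\<close> in the space form says exactly that
  \<open>(\<sigma>, v) \<noteq> 0\<close>, so that \<open>\<sigma>\<^sub>\<infinity>\<close> is defined.\<close>

definition has_cmc ::
  "'m topology \<Rightarrow> 'm chart set \<Rightarrow> ('m \<Rightarrow> (real ^ 5) set) \<Rightarrow> real ^ 5 \<Rightarrow> real \<Rightarrow> bool" where
  "has_cmc M \<A> \<Lambda> v H \<longleftrightarrow>
     conformal_surface M \<A> \<Lambda> \<and>
     (\<forall>p\<in>topspace M. sigma_inf \<Lambda> v p \<in> space_form v) \<and>
     (\<forall>c\<in>\<A>. \<forall>w\<in>chart_image c. mean_curvature (in_chart c \<Lambda>) v w = H)"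

definition cmc_surface_in ::
  "'m topology \<Rightarrow> 'm chart set \<Rightarrow> ('m \<Rightarrow> (real ^ 5) set) \<Rightarrow> real ^ 5 \<Rightarrow> bool" where
  "cmc_surface_in M \<A> \<Lambda> v \<longleftrightarrow> (\<exists>H. has_cmc M \<A> \<Lambda> v H)"

text \<open>If \<open>H = 0\<close>, either smooth unit normal qualifies.\<close>

definition unit_normal ::
  "'m chart set \<Rightarrow> ('m \<Rightarrow> (real ^ 5) set) \<Rightarrow> real ^ 5 \<Rightarrow> real \<Rightarrow> ('m \<Rightarrow> real ^ 5) \<Rightarrow> bool" where
  "unit_normal \<A> \<Lambda> v H N \<longleftrightarrow> smooth_map \<A> N \<and>
     (\<forall>c\<in>\<A>. \<forall>w\<in>chart_image c.
        cvec (in_chart c N w) \<in> perp (csc (in_chart c \<Lambda>) w) \<and>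
        lform (in_chart c N w) (in_chart c N w) = 1 \<and>
        vperp (in_chart c \<Lambda>) v w = complex_of_real H *s cvec (in_chart c N w))"

definition eta_inf ::
  "('m \<Rightarrow> (real ^ 5) set) \<Rightarrow> real ^ 5 \<Rightarrow> ('m \<Rightarrow> real ^ 5) \<Rightarrow> 'm chart \<Rightarrow> opform" where
  "eta_inf \<Lambda> v N c X f w =
     (1 / 2) *s wedge (cvec (in_chart c (sigma_inf \<Lambda> v) w))
                      (dd X (\<lambda>u. cvec (in_chart c N u)) w) (f w)"

definition q_inf ::
  "('m \<Rightarrow> (real ^ 5) set) \<Rightarrow> real ^ 5 \<Rightarrow> ('m \<Rightarrow> real ^ 5) \<Rightarrow> real \<Rightarrow> 'm chart \<Rightarrow> opform" where
  "q_inf \<Lambda> v N H c X f w = complex_of_real H *s eta_inf \<Lambda> v N c X f w"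

definition q_inf_t ::
  "('m \<Rightarrow> (real ^ 5) set) \<Rightarrow> real ^ 5 \<Rightarrow> ('m \<Rightarrow> real ^ 5) \<Rightarrow> real \<Rightarrow> real \<Rightarrow> 'm chart \<Rightarrow> opform" where
  "q_inf_t \<Lambda> v N H t c X f w =
     q_inf \<Lambda> v N H c X f w + complex_of_real t *s star (eta_inf \<Lambda> v N c) X f w"

text \<open>The section \<open>\<phi> (v\<^sup>T + (Re l H + \<i> t / 2 (l - 1 / l)) N)\<close> of the complexified trivial bundle,
  in the chart \<open>c\<close>.\<close>

definition v_spectral ::
  "('m \<Rightarrow> (real ^ 5) set) \<Rightarrow> real ^ 5 \<Rightarrow> ('m \<Rightarrow> real ^ 5) \<Rightarrow> real \<Rightarrow> real \<Rightarrow> complex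
   \<Rightarrow> ('m \<Rightarrow> real ^ 5 ^ 5) \<Rightarrow> 'm chart \<Rightarrow> complex \<Rightarrow> complex ^ 5" where
  "v_spectral \<Lambda> v N H t l \<phi> c w =
     cmat (in_chart c \<phi> w) *v
       (vtan (in_chart c \<Lambda>) v w
        + (complex_of_real (Re l * H) + \<i> * complex_of_real t / 2 * (l - 1 / l))
          *s cvec (in_chart c N w))"

end

theory Submission
  imports Defs
begin

text \<open>
  Everything is computed with the lift \<open>\<sigma> = \<sigma>\<^sub>\<infinity>\<close> and the unit normal \<open>N\<close>, using only real
  vectors. As \<open>S\<close> is the orthogonal complement of \<open>N\<close>,
  \<open>\<N>\<^sub>X g = (g,N) d\<^sub>X N - (g,d\<^sub>X N) N\<close>; and for \<open>\<bar>\<lambda>\<bar> = 1\<close> the combination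
  \<open>\<lambda>\<^sup>-\<^sup>1 \<omega>\<^sup>1\<^sup>,\<^sup>0 + \<lambda> \<omega>\<^sup>0\<^sup>,\<^sup>1\<close> is the rotated form \<open>X \<mapsto> \<omega>(\<lambda>\<^sup>-\<^sup>1 X)\<close>. With
  \<open>a = dN((\<lambda>\<^sup>-\<^sup>1 - 1) X)\<close> and \<open>b = dN((H - i t)(\<lambda>\<^sup>-\<^sup>2 - 1) X)\<close> the connection
  \<open>d\<^sup>\<lambda>\<^sup>,\<^sup>q\<close> is therefore
  \<open>g \<mapsto> d\<^sub>X g + (g,N) a - (g,a) N + \<onehalf>((g,\<sigma>) b - (g,b) \<sigma>)\<close>.
  Evaluating it on \<open>\<sigma>\<close>, on \<open>N\<close> and on \<open>v\<^sup>T + \<mu> N = v + (\<mu> - H) N\<close> gives \<open>d(\<phi>\<sigma>) = \<phi> d\<sigma>\<close>,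
  \<open>d\<^sub>X(\<phi>N) = \<phi> dN(\<lambda>\<^sup>-\<^sup>1 X)\<close>, and that the third section is parallel. The second fundamental
  form of the deformed surface is the rotated one, hence again symmetric and trace free, so \<open>\<phi>N\<close>
  is orthogonal to the central spheres of \<open>\<phi>\<Lambda>\<close> and the mean curvature is \<open>\<bar>\<mu>\<bar>\<close>. If \<open>\<phi>\<Lambda>\<close> were
  contained in a 2-sphere, \<open>\<phi>N\<close> and with it \<open>N\<close> would be constant, and \<open>\<Lambda>\<close> would lie in the
  2-sphere given by \<open>N\<close>.
\<close>

section \<open>Smooth functions\<close>

lemma dd_has_derivative:
  assumes "(f has_derivative D) (at w)"
  shows "dd X f w = D X"
  using frechet_derivative_at[OF assms] by (simp add: dd_def)

lemma differentiable_imp_dd: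
  assumes "f differentiable (at w)"
  shows "(f has_derivative (\<lambda>X. dd X f w)) (at w)"
  using assms by (simp add: dd_def frechet_derivative_works[symmetric])

lemma dd_linear:
  assumes "f differentiable (at w)"
  shows "linear (\<lambda>X. dd X f w)"
  using differentiable_imp_dd[OF assms] by (rule has_derivative_linear)

lemma dd_cong:
  assumes "f differentiable (at w)" "open V" "w \<in> V" "\<And>u. u \<in> V \<Longrightarrow> f u = g u"
  shows "dd X g w = dd X f w" "g differentiable (at w)"
proof -
  have "(g has_derivative (\<lambda>X. dd X f w)) (at w)"
    using has_derivative_transform_within_open[OF differentiable_imp_dd[OF assms(1)] assms(2-4)] by simp
  then show "dd X g w = dd X f w" "g differentiable (at w)"
    by (auto simp: dd_has_derivative differentiable_def)
qed

lemma dd_const [simp]: "dd X (\<lambda>u. c) w = 0"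
  by (simp add: dd_def)

lemma dd_add:
  assumes "f differentiable (at w)" "g differentiable (at w)"
  shows "dd X (\<lambda>u. f u + g u) w = dd X f w + dd X g w"
  by (rule dd_has_derivative, rule has_derivative_add[OF assms[THEN differentiable_imp_dd]])

lemma dd_diff:
  assumes "f differentiable (at w)" "g differentiable (at w)"
  shows "dd X (\<lambda>u. f u - g u) w = dd X f w - dd X g w"
  by (rule dd_has_derivative, rule has_derivative_diff[OF assms[THEN differentiable_imp_dd]])

lemma dd_bounded_linear:
  assumes "bounded_linear h" "f differentiable (at w)"
  shows "dd X (\<lambda>u. h (f u)) w = h (dd X f w)" "(\<lambda>u. h (f u)) differentiable (at w)"
proof -
  have "((\<lambda>u. h (f u)) has_derivative (\<lambda>X. h (dd X f w))) (at w)"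
    by (rule bounded_linear.has_derivative[OF assms(1) differentiable_imp_dd[OF assms(2)]])
  then show "dd X (\<lambda>u. h (f u)) w = h (dd X f w)" "(\<lambda>u. h (f u)) differentiable (at w)"
    by (auto simp: dd_has_derivative differentiable_def)
qed

lemma dd_bounded_bilinear:
  assumes "bounded_bilinear h" "f differentiable (at w)" "g differentiable (at w)"
  shows "dd X (\<lambda>u. h (f u) (g u)) w = h (f w) (dd X g w) + h (dd X f w) (g w)"
    and "(\<lambda>u. h (f u) (g u)) differentiable (at w)"
proof -
  have "((\<lambda>u. h (f u) (g u)) has_derivative (\<lambda>X. h (f w) (dd X g w) + h (dd X f w) (g w))) (at w)"
    by (rule bounded_bilinear.FDERIV[OF assms(1) assms(2-3)[THEN differentiable_imp_dd]])
  then show "dd X (\<lambda>u. h (f u) (g u)) w = h (f w) (dd X g w) + h (dd X f w) (g w)"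
    "(\<lambda>u. h (f u) (g u)) differentiable (at w)"
    by (auto simp: dd_has_derivative differentiable_def)
qed

section \<open>Closure properties of \<open>Ck_on\<close> and of smooth functions\<close>

lemma Ck_on_Suc_differentiable:
  "Ck_on (Suc k) V f \<Longrightarrow> open V \<Longrightarrow> w \<in> V \<Longrightarrow> f differentiable (at w)"
  by (auto simp: differentiable_on_eq_differentiable_at)

lemma Ck_on_Suc_D: "Ck_on (Suc k) V f \<Longrightarrow> Ck_on k V f"
  by (induction k arbitrary: f) (auto intro: differentiable_imp_continuous_on)

lemma Ck_on_cong:
  assumes "open V"
  shows "Ck_on k V f \<Longrightarrow> (\<And>u. u \<in> V \<Longrightarrow> f u = g u) \<Longrightarrow> Ck_on k V g"
proof (induction k arbitrary: f g)
  case 0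
  then show ?case by (metis Ck_on.simps(1) continuous_on_cong)
next
  case (Suc k)
  have d: "f differentiable (at u)" if "u \<in> V" for u
    using Ck_on_Suc_differentiable[OF Suc.prems(1) assms that] .
  have "Ck_on k V (dd X g)" for X
    using Suc.IH[of "dd X f" "dd X g"] Suc.prems(1) dd_cong(1)[OF d assms _ Suc.prems(2)] by auto
  moreover have "g differentiable_on V"
    using dd_cong(2)[OF d assms _ Suc.prems(2)] assms
    by (auto simp: differentiable_on_eq_differentiable_at)
  ultimately show ?case by simp
qed

text \<open>Through \<open>smooth_on_local\<close> this glues the smoothness of
  \<open>sigma_inf\<close> from sections of the line bundle that are given only near each
  point.\<close>

lemma Ck_on_local:
  assumes "open V" "\<And>w. w \<in> V \<Longrightarrow> \<exists>U. open U \<and> w \<in> U \<and> Ck_on k U f"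
  shows "Ck_on k V f"
  using assms
proof (induction k arbitrary: f)
  case 0
  then show ?case
    by (auto simp: continuous_on_eq_continuous_at)
      (metis at_within_open continuous_on_eq_continuous_within)
next
  case (Suc k)
  have "f differentiable_on V"
    using Suc.prems by (meson Ck_on_Suc_differentiable differentiable_on_eq_differentiable_at)
  moreover have "Ck_on k V (dd X f)" for X
    by (rule Suc.IH[OF Suc.prems(1)]) (use Suc.prems(2) in fastforce)
  ultimately show ?case by simp
qed

lemma Ck_on_subset: "Ck_on k V f \<Longrightarrow> U \<subseteq> V \<Longrightarrow> Ck_on k U f"
  by (induction k arbitrary: f) (auto intro: continuous_on_subset differentiable_on_subset)

lemma Ck_on_const [simp]: "Ck_on k V (\<lambda>u. c)"
proof (induction k arbitrary: c)
  case (Suc k)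
  moreover have "dd X (\<lambda>u. c) = (\<lambda>u. 0)" for X by (rule ext) simp
  ultimately show ?case by simp
qed simp

lemma Ck_on_add:
  assumes "open V"
  shows "Ck_on k V f \<Longrightarrow> Ck_on k V g \<Longrightarrow> Ck_on k V (\<lambda>u. f u + g u)"
proof (induction k arbitrary: f g)
  case 0
  then show ?case by (simp add: continuous_on_add)
next
  case (Suc k)
  have d: "f differentiable (at u)" "g differentiable (at u)" if "u \<in> V" for u
    using Suc.prems assms that Ck_on_Suc_differentiable by blast+
  have "Ck_on k V (dd X (\<lambda>u. f u + g u))" for X
    by (rule Ck_on_cong[OF assms, of _ "\<lambda>u. dd X f u + dd X g u"])
      (use Suc d in \<open>auto simp: dd_add\<close>)
  with Suc.prems show ?case by (simp add: differentiable_on_add)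
qed

lemma Ck_on_bounded_bilinear:
  assumes "open V" "bounded_bilinear h"
  shows "Ck_on k V f \<Longrightarrow> Ck_on k V g \<Longrightarrow> Ck_on k V (\<lambda>u. h (f u) (g u))"
proof (induction k arbitrary: f g)
  case 0
  then show ?case using bounded_bilinear.continuous_on[OF assms(2)] by auto
next
  case (Suc k)
  have d: "f differentiable (at u)" "g differentiable (at u)" if "u \<in> V" for u
    using Suc.prems assms that Ck_on_Suc_differentiable by blast+
  have "Ck_on k V (\<lambda>u. h (f u) (dd X g u) + h (dd X f u) (g u))" for X
    using Suc.prems Suc.prems[THEN Ck_on_Suc_D] by (intro Ck_on_add assms Suc.IH) auto
  then have "Ck_on k V (dd X (\<lambda>u. h (f u) (g u)))" for X
    by (rule Ck_on_cong[OF assms(1)]) (simp add: dd_bounded_bilinear[OF assms(2)] d)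
  moreover have "(\<lambda>u. h (f u) (g u)) differentiable_on V"
    using dd_bounded_bilinear(2)[OF assms(2)] d assms(1)
    by (simp add: differentiable_on_eq_differentiable_at)
  ultimately show ?case by simp
qed

text \<open>The derivative of \<open>1 / r\<close> is minus the product of two copies of
  \<open>1 / r\<close> with the derivative of \<open>r\<close>, so closure under products and the
  induction hypothesis for the same \<open>r\<close> suffice.\<close>

lemma Ck_on_inverse:
  fixes r :: "complex \<Rightarrow> real"
  assumes "open V" "\<And>u. u \<in> V \<Longrightarrow> r u \<noteq> 0"
  shows "Ck_on k V r \<Longrightarrow> Ck_on k V (\<lambda>u. inverse (r u))"
proof (induction k)
  case 0
  then show ?case using assms by (auto intro: continuous_on_inverse)
next
  case (Suc k)
  have d: "((\<lambda>u. inverse (r u)) has_derivative (\<lambda>X. - (inverse (r u) * dd X r u * inverse (r u)))) (at u)"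
    if "u \<in> V" for u
    by (rule Deriv.has_derivative_inverse[OF assms(2)[OF that]
          differentiable_imp_dd[OF Ck_on_Suc_differentiable[OF Suc.prems assms(1) that]]])
  have i: "Ck_on k V (\<lambda>u. inverse (r u))"
    using Suc Ck_on_Suc_D by blast
  have "Ck_on k V (\<lambda>u. (-1) * (inverse (r u) * dd X r u * inverse (r u)))" for X
    using i Suc.prems
    by (intro Ck_on_bounded_bilinear[OF assms(1) bounded_bilinear_mult] Ck_on_const) auto
  then have "Ck_on k V (dd X (\<lambda>u. inverse (r u)))" for X
    by (rule Ck_on_cong[OF assms(1), where f = "\<lambda>u. (-1) * (inverse (r u) * dd X r u * inverse (r u))"])
      (simp add: dd_has_derivative[OF d])
  moreover have "(\<lambda>u. inverse (r u)) differentiable_on V"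
    using d assms(1) by (auto simp: differentiable_on_eq_differentiable_at differentiable_def)
  ultimately show ?case by simp
qed

lemma smooth_on_differentiable: "smooth_on V f \<Longrightarrow> open V \<Longrightarrow> w \<in> V \<Longrightarrow> f differentiable (at w)"
  unfolding smooth_on_def using Ck_on_Suc_differentiable by blast

lemma smooth_on_dd: "smooth_on V f \<Longrightarrow> smooth_on V (dd X f)"
  unfolding smooth_on_def by (metis Ck_on.simps(2))

lemma smooth_on_subset: "smooth_on V f \<Longrightarrow> U \<subseteq> V \<Longrightarrow> smooth_on U f"
  unfolding smooth_on_def using Ck_on_subset by blast

lemma smooth_on_cong:
  "open V \<Longrightarrow> smooth_on V f \<Longrightarrow> (\<And>u. u \<in> V \<Longrightarrow> f u = g u) \<Longrightarrow> smooth_on V g"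
  unfolding smooth_on_def using Ck_on_cong by blast

lemma smooth_on_local:
  assumes "open V" "\<And>w. w \<in> V \<Longrightarrow> \<exists>U. open U \<and> w \<in> U \<and> smooth_on U f"
  shows "smooth_on V f"
  using assms unfolding smooth_on_def by (meson Ck_on_local)

lemma smooth_on_const [simp]: "smooth_on V (\<lambda>u. c)"
  by (simp add: smooth_on_def)

lemma smooth_on_add:
  "open V \<Longrightarrow> smooth_on V f \<Longrightarrow> smooth_on V g \<Longrightarrow> smooth_on V (\<lambda>u. f u + g u)"
  by (simp add: smooth_on_def Ck_on_add)

lemma smooth_on_bounded_bilinear:
  "bounded_bilinear h \<Longrightarrow> open V \<Longrightarrow> smooth_on V f \<Longrightarrow> smooth_on V g \<Longrightarrow>
    smooth_on V (\<lambda>u. h (f u) (g u))"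
  by (simp add: smooth_on_def Ck_on_bounded_bilinear)

lemma smooth_on_inverse:
  fixes r :: "complex \<Rightarrow> real"
  shows "open V \<Longrightarrow> smooth_on V r \<Longrightarrow> (\<And>u. u \<in> V \<Longrightarrow> r u \<noteq> 0) \<Longrightarrow> smooth_on V (\<lambda>u. inverse (r u))"
  by (simp add: smooth_on_def Ck_on_inverse)

section \<open>Minkowski space\<close>

lemma lform_add_left: "lform (x + y) z = lform x z + lform y z"
  and lform_add_right: "lform z (x + y) = lform z x + lform z y"
  and lform_diff_left: "lform (x - y) z = lform x z - lform y z"
  and lform_diff_right: "lform z (x - y) = lform z x - lform z y"
  and lform_scale_left: "lform (c *s x) z = c * lform x z"
  and lform_scale_right: "lform z (c *s x) = c * lform z x"
  and lform_minus_left: "lform (- x) z = - lform x z"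
  and lform_minus_right: "lform z (- x) = - lform z x"
  and lform_zero_left: "lform 0 z = 0"
  and lform_zero_right: "lform z 0 = 0"
  by (auto simp: lform_def algebra_simps sum_distrib_left simp flip: sum.distrib sum_subtractf
      sum_negf intro!: sum.cong)

lemma lform_sym: "lform x y = lform y x"
  by (simp add: lform_def mult.commute)

lemma lform_scaleR_left: "lform (c *\<^sub>R x) z = c * lform x z"
  and lform_scaleR_right: "lform z (c *\<^sub>R x) = c * lform z x"
  using lform_scale_left[of c x z] lform_scale_right[of z c x] by (simp_all add: scalar_mult_eq_scaleR)

lemmas lform_simps = lform_add_left lform_add_right lform_diff_left lform_diff_right
  lform_scale_left lform_scale_right lform_scaleR_left lform_scaleR_right
  lform_minus_left lform_minus_right lform_zero_left lform_zero_right

lemma bounded_bilinear_lform: "bounded_bilinear (lform :: real ^ 5 \<Rightarrow> _)"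
  by (rule bilinear_conv_bounded_bilinear[THEN iffD1])
    (auto simp: bilinear_def lform_simps intro!: linearI)

lemma bounded_bilinear_matrix_vector:
  "bounded_bilinear ((*v) :: real ^ 'n ^ 'm \<Rightarrow> real ^ 'n \<Rightarrow> real ^ 'm)"
  by (rule bilinear_conv_bounded_bilinear[THEN iffD1])
    (auto simp: bilinear_def matrix_vector_mult_add_rdistrib matrix_vector_right_distrib
      matrix_vector_mult_scaleR scaleR_matrix_vector_assoc intro!: linearI)

lemma lform_nondegenerate:
  fixes x :: "'a::comm_ring_1 ^ 5"
  assumes "\<And>y. lform x y = 0"
  shows "x = 0"
proof (rule vec_eq_iff[THEN iffD2], rule allI)
  fix i
  have "lform x (axis i 1) = (\<Sum>j\<in>UNIV. if j = i then (if i = 0 then - 1 else 1) * x $ i else 0)"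
    unfolding lform_def axis_def by (intro sum.cong) auto
  then have "lform x (axis i 1) = (if i = 0 then - 1 else 1) * x $ i" by simp
  with assms show "x $ i = 0 $ i" by (auto split: if_splits)
qed

section \<open>Real vectors inside the complexified space\<close>

lemma cvec_add: "cvec (x + y) = cvec x + cvec y"
  and cvec_diff: "cvec (x - y) = cvec x - cvec y"
  and cvec_scaleR: "cvec (c *\<^sub>R x) = complex_of_real c *s cvec x"
  by (simp_all add: cvec_def vec_eq_iff)

lemma cvec_inject [simp]: "cvec x = cvec y \<longleftrightarrow> x = y"
  by (simp add: cvec_def vec_eq_iff)

lemma lform_cvec: "lform (cvec x) (cvec y) = complex_of_real (lform x y)"
  by (auto simp: lform_def cvec_def intro!: sum.cong)

lemma cmat_cvec: "cmat A *v cvec x = cvec (A *v x)"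
  by (simp add: cmat_def cvec_def vec_eq_iff matrix_vector_mult_def)

lemma bounded_linear_cvec: "bounded_linear cvec"
  by (rule linear_conv_bounded_linear[THEN iffD1], rule linearI)
    (simp_all add: vec_eq_iff cvec_def scaleR_conv_of_real[where 'a = complex])

lemma dd_cvec:
  assumes "f differentiable (at w)"
  shows "dd X (\<lambda>u. cvec (f u)) w = cvec (dd X f w)"
  by (rule dd_bounded_linear(1)[OF bounded_linear_cvec assms])

text \<open>Subtracting the multiple of \<open>s\<close> that cancels the time coordinate of
  \<open>x\<close> leaves \<open>lform x x\<close> unchanged and reduces it to a Euclidean sum of
  squares. For \<open>x\<close> a derivative of the lift this makes the induced metric
  positive.\<close>

lemma null_perp_pos:
  fixes x s :: "real ^ 5"
  assumes "lform s s = 0" "s \<noteq> 0" "lform x s = 0" "x \<notin> span {s}"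
  shows "lform x x > 0"
proof -
  have split: "lform y z = (\<Sum>i\<in>UNIV - {0}. y $ i * z $ i) - y $ 0 * z $ 0" for y z :: "real ^ 5"
    unfolding lform_def by (subst sum.remove[of _ 0]) auto
  have s0: "s $ 0 \<noteq> 0"
  proof
    assume 0: "s $ 0 = 0"
    then have "(\<Sum>i\<in>UNIV - {0}. (s $ i)\<^sup>2) = 0"
      using assms(1) split[of s s] by (simp add: power2_eq_square)
    then have "\<forall>i\<in>UNIV - {0}. s $ i = 0"
      by (subst (asm) sum_nonneg_eq_0_iff) auto
    then have "s $ i = 0" for i using 0 by (cases "i = 0") auto
    then have "s = 0" by (simp add: vec_eq_iff)
    with assms(2) show False by simp
  qed
  define y where "y = x - (x $ 0 / s $ 0) *\<^sub>R s"
  have y0: "y $ 0 = 0" using s0 by (simp add: y_def)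
  have "lform x x = lform y y"
    using assms(1,3) by (simp add: y_def lform_simps lform_sym[of s x])
  also have "\<dots> = (\<Sum>i\<in>UNIV - {0}. (y $ i)\<^sup>2)"
    using y0 by (simp add: split power2_eq_square)
  finally have e: "lform x x = (\<Sum>i\<in>UNIV - {0}. (y $ i)\<^sup>2)" .
  have "y \<noteq> 0"
    using assms(4) by (auto simp: y_def span_singleton)
  then obtain i where "y $ i \<noteq> 0" by (auto simp: vec_eq_iff)
  moreover from this y0 have "i \<noteq> 0" by metis
  ultimately have "lform x x \<noteq> 0"
    unfolding e by (subst sum_nonneg_eq_0_iff) auto
  moreover have "lform x x \<ge> 0" unfolding e by (intro sum_nonneg) auto
  ultimately show ?thesis by simp
qed

section \<open>Null frames, hyperplanes and orthogonal projections\<close>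

lemma exhaust_5:
  fixes x :: 5
  shows "x = 0 \<or> x = 1 \<or> x = 2 \<or> x = 3 \<or> x = 4"
proof (induct x)
  case (of_int z)
  then have "z = 0 \<or> z = 1 \<or> z = 2 \<or> z = 3 \<or> z = 4" by fastforce
  then show ?case by auto
qed

text \<open>Meant for a section \<open>s\<close> of the line bundle with \<open>z\<close>,
  \<open>y\<close>, \<open>L\<close> its derivatives by \<open>dz\<close>, \<open>dzbar\<close> and
  \<open>dzbar\<close> after \<open>dz\<close>. Pairing a vanishing combination with
  \<open>s\<close>, \<open>z\<close>, \<open>y\<close>, \<open>n\<close> removes the coefficients of
  \<open>L\<close>, \<open>y\<close>, \<open>z\<close>, \<open>n\<close> in this order, so the five
  vectors form a basis.\<close>

lemma frame_span:
  fixes s z y L n :: "complex ^ 5"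
  assumes "lform s s = 0" "lform s z = 0" "lform s y = 0" "lform s L \<noteq> 0"
    and "lform z z = 0" "lform y y = 0" "lform z y \<noteq> 0"
    and "lform s n = 0" "lform z n = 0" "lform y n = 0" "lform L n = 0" "lform n n \<noteq> 0"
  shows "vec.span {s, z, y, L} = {x. lform x n = 0}"
proof
  have "vec.subspace {x. lform x n = 0}"
    by (auto simp: vec.subspace_def lform_simps)
  then show "vec.span {s, z, y, L} \<subseteq> {x. lform x n = 0}"
    using assms by (intro vec.span_minimal subsetI) (elim insertE emptyE; simp)
  \<comment> \<open>As an endomorphism of a five-dimensional space, \<open>T\<close> is onto once it
    is injective.\<close>
  define T where "T c = c $ 0 *s s + c $ 1 *s z + c $ 2 *s y + c $ 3 *s L + c $ 4 *s n"
    for c :: "complex ^ 5"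
  have lin: "Vector_Spaces.linear (*s) (*s) T"
    by unfold_locales (auto simp: T_def vec_eq_iff algebra_simps)
  have T0: "c = 0" if "T c = 0" for c
  proof -
    have "lform s (T c) = 0" using that by (simp add: lform_simps)
    then have 3: "c $ 3 = 0" using assms by (simp add: T_def lform_simps)
    have "lform z (T c) = 0" using that by (simp add: lform_simps)
    then have 2: "c $ 2 = 0" using assms 3 by (simp add: T_def lform_simps lform_sym[of z s])
    have "lform y (T c) = 0" using that by (simp add: lform_simps)
    then have 1: "c $ 1 = 0" using assms 3 by (simp add: T_def lform_simps lform_sym[of y s] lform_sym[of y z])
    have "lform (T c) n = 0" using that by (simp add: lform_simps)
    then have 4: "c $ 4 = 0" using assms by (simp add: T_def lform_simps)
    have "c $ 0 *s s = 0" using that 1 2 3 4 by (simp add: T_def)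
    moreover have "s \<noteq> 0" using assms(4) by (auto simp: lform_simps)
    ultimately have "c $ 0 = 0" by simp
    with 1 2 3 4 have "c $ i = 0" for i using exhaust_5[of i] by auto
    then show "c = 0" by (simp add: vec_eq_iff)
  qed
  have "inj T" using vec.linear_inj_iff_eq_0[OF lin] T0 by auto
  then have surj: "surj T" using vec.linear_inj_imp_surj[OF lin] by blast
  show "{x. lform x n = 0} \<subseteq> vec.span {s, z, y, L}"
  proof
    fix x assume x: "x \<in> {x. lform x n = 0}"
    obtain c where c: "x = T c" using surj by (metis surj_def)
    have "c $ 4 = 0" using x assms by (simp add: c T_def lform_simps)
    then have "x = c $ 0 *s s + c $ 1 *s z + c $ 2 *s y + c $ 3 *s L" by (simp add: c T_def)
    moreover have "\<dots> \<in> vec.span {s, z, y, L}"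
      by (intro vec.span_add vec.span_scale vec.span_base) auto
    ultimately show "x \<in> vec.span {s, z, y, L}" by simp
  qed
qed

text \<open>Every vector splits into a part in the hyperplane and a multiple of \<open>n\<close>, so
  an \<open>x\<close> orthogonal to the hyperplane differs from its \<open>n\<close>-component by a
  vector orthogonal to everything. The right-hand side is the line through \<open>n\<close>, written
  without an existential.\<close>

lemma perp_hyperplane:
  fixes n :: "complex ^ 5"
  assumes "lform n n = 1"
  shows "perp {x. lform x n = 0} = {x. x = lform x n *s n}"
proof (intro equalityI subsetI)
  fix x assume x: "x \<in> perp {x. lform x n = 0}"
  have "lform (x - lform x n *s n) z = 0" for z
  proof -
    have "lform (z - lform z n *s n) n = 0"
      using assms by (simp add: lform_simps)
    with x have "lform x (z - lform z n *s n) = 0" unfolding perp_def by blast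
    then show ?thesis by (simp add: lform_simps lform_sym[of z n] mult.commute)
  qed
  then have "x - lform x n *s n = 0" by (rule lform_nondegenerate)
  then show "x \<in> {x. x = lform x n *s n}" by simp
next
  fix x assume "x \<in> {x. x = lform x n *s n}"
  then have x: "x = lform x n *s n" by simp
  show "x \<in> perp {x. lform x n = 0}"
    unfolding perp_def by (subst x) (auto simp: lform_simps lform_sym[of n])
qed

lemma oproj_hyperplane:
  fixes n :: "complex ^ 5"
  assumes "lform n n = 1"
  shows "oproj {x. lform x n = 0} v = v - lform v n *s n"
    and "oproj (perp {x. lform x n = 0}) v = lform v n *s n"
proof -
  show "oproj {x. lform x n = 0} v = v - lform v n *s n"
    unfolding oproj_def perp_hyperplane[OF assms]
  proof (rule the_equality)
    fix x assume "x \<in> {x. lform x n = 0} \<and> v - x \<in> {x. x = lform x n *s n}"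
    then show "x = v - lform v n *s n" by (auto simp: lform_simps algebra_simps)
  qed (use assms in \<open>auto simp: lform_simps\<close>)
  have pp: "perp {x. x = lform x n *s n} = {x. lform x n = 0}"
  proof (intro equalityI subsetI)
    fix x assume "x \<in> perp {x. x = lform x n *s n}"
    then show "x \<in> {x. lform x n = 0}" using assms by (auto simp: perp_def)
  next
    fix x assume "x \<in> {x. lform x n = 0}"
    then show "x \<in> perp {x. x = lform x n *s n}"
      unfolding perp_def by (clarsimp, metis lform_scale_right mult_zero_right)
  qed
  show "oproj (perp {x. lform x n = 0}) v = lform v n *s n"
    unfolding oproj_def perp_hyperplane[OF assms] pp
  proof (rule the_equality)
    fix x assume "x \<in> {x. x = lform x n *s n} \<and> v - x \<in> {x. lform x n = 0}"
    then show "x = lform v n *s n" by (auto simp: lform_simps)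
  qed (use assms in \<open>auto simp: lform_simps\<close>)
qed

section \<open>Lifts and central spheres\<close>

lemma linear_dd_complex:
  assumes "f differentiable (at w)"
  shows "dd X f w = Re X *\<^sub>R dd 1 f w + Im X *\<^sub>R dd \<i> f w"
proof -
  note l = dd_linear[OF assms]
  have "dd X f w = dd (Re X *\<^sub>R 1 + Im X *\<^sub>R \<i>) f w"
    by (rule arg_cong[of _ _ "\<lambda>Y. dd Y f w"]) (simp add: complex_eq_iff)
  also have "\<dots> = Re X *\<^sub>R dd 1 f w + Im X *\<^sub>R dd \<i> f w"
    by (simp only: linear_add[OF l] linear_scale[OF l])
  finally show ?thesis .
qed

lemma dd_lform:
  fixes f g :: "complex \<Rightarrow> real ^ 5"
  assumes "f differentiable (at w)" "g differentiable (at w)"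
  shows "dd X (\<lambda>u. lform (f u) (g u)) w = lform (f w) (dd X g w) + lform (dd X f w) (g w)"
    and "(\<lambda>u. lform (f u) (g u)) differentiable (at w)"
  using dd_bounded_bilinear[OF bounded_bilinear_lform assms] by auto

text \<open>Applied to the orthogonality relations of the moving frame, this turns pairings with
  second derivatives into pairings of first derivatives.\<close>

lemma dd_lform_const:
  fixes f g :: "complex \<Rightarrow> real ^ 5"
  assumes "open V" "w \<in> V" "f differentiable (at w)" "g differentiable (at w)"
    and "\<And>u. u \<in> V \<Longrightarrow> lform (f u) (g u) = c"
  shows "lform (dd X f w) (g w) + lform (f w) (dd X g w) = 0"
proof -
  have "dd X (\<lambda>u. c) w = dd X (\<lambda>u. lform (f u) (g u)) w"
    by (rule dd_cong(1)[OF dd_lform(2)[OF assms(3,4)] assms(1,2,5)])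
  then show ?thesis using dd_lform(1)[OF assms(3,4)] by simp
qed

lemma dd_scaleR:
  fixes f :: "complex \<Rightarrow> real"
  assumes "f differentiable (at w)" "g differentiable (at w)"
  shows "dd X (\<lambda>u. f u *\<^sub>R g u) w = f w *\<^sub>R dd X g w + dd X f w *\<^sub>R g w"
    and "(\<lambda>u. f u *\<^sub>R g u) differentiable (at w)"
  using dd_bounded_bilinear[OF bounded_bilinear_scaleR assms] by auto

lemma bounded_linear_scale_cvec: "bounded_linear (\<lambda>x. c *s cvec x)"
  by (rule linear_conv_bounded_linear[THEN iffD1], rule linearI)
    (simp_all add: vec_eq_iff cvec_def scaleR_conv_of_real[where 'a = complex] algebra_simps)

lemma dz_cvec:
  assumes "f differentiable (at w)"
  shows "dz (\<lambda>u. cvec (f u)) w = (1 / 2) *s cvec (dd 1 f w) - (\<i> / 2) *s cvec (dd \<i> f w)"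
    and "dzbar (\<lambda>u. cvec (f u)) w = (1 / 2) *s cvec (dd 1 f w) + (\<i> / 2) *s cvec (dd \<i> f w)"
  by (simp_all add: dz_def dzbar_def dd_cvec[OF assms] vec_eq_iff algebra_simps)

text \<open>The term with \<open>\<i> / 4\<close> is the commutator of the derivatives in the
  directions \<open>1\<close> and \<open>\<i>\<close>. It is kept, so that orthogonality of a real
  vector to this expression yields two real equations.\<close>

lemma dzbar_dz_cvec:
  assumes "open V" "w \<in> V" "smooth_on V f"
  shows "dzbar (dz (\<lambda>u. cvec (f u))) w =
    (1 / 4) *s cvec (dd 1 (dd 1 f) w + dd \<i> (dd \<i> f) w) +
    (\<i> / 4) *s cvec (dd \<i> (dd 1 f) w - dd 1 (dd \<i> f) w)"
proof -
  note d = smooth_on_differentiable[OF assms(3,1)]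
  have d': "dd X f differentiable (at w)" for X
    using smooth_on_differentiable[OF smooth_on_dd[OF assms(3)] assms(1,2)] .
  define k where "k = (\<lambda>u. (1 / 2) *s cvec (dd 1 f u) - (\<i> / 2) *s cvec (dd \<i> f u))"
  have kd: "k differentiable (at w)"
    unfolding k_def
    by (intro differentiable_diff dd_bounded_linear(2)[OF bounded_linear_scale_cvec] d')
  have k: "dd X k w = (1 / 2) *s cvec (dd X (dd 1 f) w) - (\<i> / 2) *s cvec (dd X (dd \<i> f) w)" for X
    unfolding k_def
    by (simp only: dd_diff dd_bounded_linear[OF bounded_linear_scale_cvec] d')
  have z: "dd X (dz (\<lambda>u. cvec (f u))) w = dd X k w" for X
    by (rule dd_cong(1)[OF kd assms(1,2)]) (simp add: k_def dz_cvec d)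
  show ?thesis
    unfolding dzbar_def z k by (simp add: vec_eq_iff cvec_def algebra_simps)
qed

text \<open>What the surface definitions demand of all sections is assumed here for one lift only;
  \<open>section_multiple\<close> carries it to the others. With \<open>v\<close> arbitrary, the
  locale serves both \<open>\<Lambda>\<close> and the deformed surface.\<close>

locale normalized_lift =
  fixes V :: "complex set" and \<Lambda> :: "complex \<Rightarrow> (real ^ 5) set"
    and \<sigma> :: "complex \<Rightarrow> real ^ 5" and v :: "real ^ 5"
  assumes open_V: "open V"
    and smooth: "smooth_on V \<sigma>"
    and line: "w \<in> V \<Longrightarrow> \<Lambda> w = span {\<sigma> w}"
    and null: "w \<in> V \<Longrightarrow> lform (\<sigma> w) (\<sigma> w) = 0"
    and normalized: "w \<in> V \<Longrightarrow> lform (\<sigma> w) v = - 1"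
    and immersion: "w \<in> V \<Longrightarrow> X \<noteq> 0 \<Longrightarrow> dd X \<sigma> w \<notin> span {\<sigma> w}"
    and conformal: "w \<in> V \<Longrightarrow>
      lform (dd (\<i> * X) \<sigma> w) (dd (\<i> * Y) \<sigma> w) = lform (dd X \<sigma> w) (dd Y \<sigma> w)"
begin

lemma nonzero: "w \<in> V \<Longrightarrow> \<sigma> w \<noteq> 0"
  using normalized[of w] by (auto simp: lform_simps)

lemma differentiable: "w \<in> V \<Longrightarrow> \<sigma> differentiable (at w)"
  using smooth_on_differentiable[OF smooth open_V] .

lemma nz_section_lift: "nz_section V \<Lambda> \<sigma>"
  using open_V smooth nonzero line by (auto simp: nz_section_def span_base)

lemma null_dd: "w \<in> V \<Longrightarrow> lform (\<sigma> w) (dd X \<sigma> w) = 0"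
  using dd_lform_const[OF open_V _ differentiable differentiable null, of w X]
  by (simp add: lform_sym[of "dd X \<sigma> w"])

text \<open>Conformality for the pair \<open>1\<close>, \<open>\<i>\<close> equates this product
  with its own negative, because \<open>\<i> * \<i> = - 1\<close>.\<close>

lemma conformal_orthogonal: "w \<in> V \<Longrightarrow> lform (dd 1 \<sigma> w) (dd \<i> \<sigma> w) = 0"
  using conformal[of w 1 "\<i>"] linear_neg[OF dd_linear[OF differentiable], of w 1]
  by (simp add: lform_simps lform_sym[of "dd \<i> \<sigma> w"])

lemma conformal_equal: "w \<in> V \<Longrightarrow> lform (dd \<i> \<sigma> w) (dd \<i> \<sigma> w) = lform (dd 1 \<sigma> w) (dd 1 \<sigma> w)"
  using conformal[of w 1 1] by simp

lemma metric_pos: "w \<in> V \<Longrightarrow> lform (dd 1 \<sigma> w) (dd 1 \<sigma> w) > 0"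
  using null_perp_pos[OF null nonzero _ immersion, of w 1] null_dd[of w 1]
  by (simp add: lform_sym[of "\<sigma> w"])

text \<open>Pairing with \<open>v\<close> reads off the factor between \<open>s\<close> and
  \<open>\<sigma>\<close> as a bounded linear function of \<open>s\<close>, so it is differentiable
  and the product rule applies.\<close>

lemma section_multiple:
  assumes "nz_section V' \<Lambda> s" "w \<in> V" "w \<in> V'"
  defines "f \<equiv> - lform (s w) v"
  shows "s w = f *\<^sub>R \<sigma> w" "f \<noteq> 0"
    and "dd X s w = f *\<^sub>R dd X \<sigma> w - lform (dd X s w) v *\<^sub>R \<sigma> w"
proof -
  have mult: "s u = (- lform (s u) v) *\<^sub>R \<sigma> u" if "u \<in> V \<inter> V'" for u
  proof -
    have "s u \<in> span {\<sigma> u}" using assms(1) that line[of u] by (auto simp: nz_section_def)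
    then obtain r where "s u = r *\<^sub>R \<sigma> u" by (auto simp: span_singleton)
    with normalized[of u] that show ?thesis by (simp add: lform_simps)
  qed
  have W: "open (V \<inter> V')" "w \<in> V \<inter> V'" using assms open_V by (auto simp: nz_section_def)
  then show 1: "s w = f *\<^sub>R \<sigma> w" using mult f_def by blast
  show "f \<noteq> 0" using 1 assms(1,3) by (auto simp: nz_section_def)
  have ds: "s differentiable (at w)"
    using assms(1,3) smooth_on_differentiable by (auto simp: nz_section_def)
  have df: "(\<lambda>u. - lform (s u) v) differentiable (at w)"
    "dd X (\<lambda>u. - lform (s u) v) w = - lform (dd X s w) v"
  proof -
    have b: "bounded_linear (\<lambda>x. - lform x v)"
      using bounded_bilinear.bounded_linear_left[OF bounded_bilinear_lform]
      by (rule bounded_linear_minus)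
    show "(\<lambda>u. - lform (s u) v) differentiable (at w)"
      "dd X (\<lambda>u. - lform (s u) v) w = - lform (dd X s w) v"
      using dd_bounded_linear[OF b ds] by auto
  qed
  have "dd X s w = dd X (\<lambda>u. (- lform (s u) v) *\<^sub>R \<sigma> u) w"
    by (rule dd_cong(1)[OF dd_scaleR(2)[OF df(1) differentiable[OF assms(2)]] W])
      (use mult in simp)
  also have "\<dots> = f *\<^sub>R dd X \<sigma> w - lform (dd X s w) v *\<^sub>R \<sigma> w"
    by (simp only: dd_scaleR(1)[OF df(1) differentiable[OF assms(2)]] df(2) f_def) simp
  finally show "dd X s w = f *\<^sub>R dd X \<sigma> w - lform (dd X s w) v *\<^sub>R \<sigma> w" .
qed

text \<open>Multiples of \<open>\<sigma>\<close> do not contribute, since \<open>\<sigma>\<close> is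
  null and orthogonal to its derivatives.\<close>

lemma section_metric:
  assumes "nz_section V' \<Lambda> s" "w \<in> V" "w \<in> V'"
  shows "lform (dd X s w) (dd Y s w) = (lform (s w) v)\<^sup>2 * lform (dd X \<sigma> w) (dd Y \<sigma> w)"
  by (subst (1 2) section_multiple(3)[OF assms])
    (use assms(2) null null_dd in
      \<open>simp add: lform_simps power2_eq_square lform_sym[of "dd X \<sigma> w" "\<sigma> w"]\<close>)

lemma null_line_subbundle_V: "null_line_subbundle V \<Lambda>"
  unfolding null_line_subbundle_def lightcone_def
  using nz_section_lift line null nonzero by blast

lemma immersive_V: "immersive V \<Lambda>"
  unfolding immersive_def
proof (intro allI impI ballI notI)
  fix V' s w X
  assume a: "V' \<subseteq> V" "nz_section V' \<Lambda> s" "w \<in> V'" "X \<noteq> (0::complex)" "dd X s w \<in> \<Lambda> w"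
  then have w: "w \<in> V" by auto
  note m = section_multiple[OF a(2) w a(3)]
  define f where "f = - lform (s w) v"
  have "dd X s w + lform (dd X s w) v *\<^sub>R \<sigma> w \<in> span {\<sigma> w}"
    using a(5) line[OF w] by (simp add: span_add span_scale span_base)
  then have "f *\<^sub>R dd X \<sigma> w \<in> span {\<sigma> w}"
    by (subst (asm) m(3)) (simp add: f_def)
  then have "(1 / f) *\<^sub>R f *\<^sub>R dd X \<sigma> w \<in> span {\<sigma> w}" by (rule span_scale)
  with m(2) immersion[OF w a(4)] show False by (simp add: f_def)
qed

lemma conformal_coordinate_V: "conformal_coordinate V \<Lambda>"
  unfolding conformal_coordinate_def induced_metric_def
  by (auto simp: section_metric conformal subset_iff)

end

text \<open>
  The second fundamental form is \<open>h X Y = - lform (dd X N w) (dd Y \<sigma> w)\<close>. Its symmetry and vanishing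
  trace together say that \<open>N\<close> is orthogonal to \<open>dzbar (dz \<sigma>)\<close>; stated this way they survive
  a rotation of \<open>dd X N\<close>, and the symmetry of second derivatives of \<open>\<sigma>\<close> is never needed.
\<close>

locale framed_lift = normalized_lift +
  fixes N :: "complex \<Rightarrow> real ^ 5"
  assumes smooth_N: "smooth_on V N"
    and N_unit: "w \<in> V \<Longrightarrow> lform (N w) (N w) = 1"
    and N_lift: "w \<in> V \<Longrightarrow> lform (N w) (\<sigma> w) = 0"
    and N_dd: "w \<in> V \<Longrightarrow> lform (N w) (dd X \<sigma> w) = 0"
    and h_sym: "w \<in> V \<Longrightarrow> lform (dd \<i> N w) (dd 1 \<sigma> w) = lform (dd 1 N w) (dd \<i> \<sigma> w)"
    and h_trace: "w \<in> V \<Longrightarrow>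
      lform (dd 1 N w) (dd 1 \<sigma> w) + lform (dd \<i> N w) (dd \<i> \<sigma> w) = 0"
begin

lemma N_differentiable: "w \<in> V \<Longrightarrow> N differentiable (at w)"
  using smooth_on_differentiable[OF smooth_N open_V] .

lemma dN_N: "w \<in> V \<Longrightarrow> lform (dd X N w) (N w) = 0"
  using dd_lform_const[OF open_V _ N_differentiable N_differentiable N_unit, of w X]
  by (simp add: lform_sym[of "N w" "dd X N w"])

lemma dN_lift: "w \<in> V \<Longrightarrow> lform (dd X N w) (\<sigma> w) = 0"
  using dd_lform_const[OF open_V _ N_differentiable differentiable N_lift, of w X]
  by (simp add: N_dd)

text \<open>As \<open>csc\<close> is a union over all sections, the span has to be found for each of
  them. That it is always the hyperplane orthogonal to \<open>N\<close> also shows its independence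
  of \<open>s\<close>.\<close>

lemma section_frame_span:
  assumes s: "nz_section V' \<Lambda> s" and w: "w \<in> V" "w \<in> V'"
  shows "(let f = (\<lambda>u. cvec (s u)) in vec.span {f w, dz f w, dzbar f w, dzbar (dz f) w})
    = {x. lform x (cvec (N w)) = 0}"
proof -
  define W where "W = V \<inter> V'"
  have W: "open W" "w \<in> W" using s w open_V by (auto simp: W_def nz_section_def)
  have sm: "smooth_on W s" using s by (auto simp: W_def nz_section_def intro: smooth_on_subset)
  note ds = smooth_on_differentiable[OF sm W(1)]
  note dds = smooth_on_differentiable[OF smooth_on_dd[OF sm] W(1)]
  have mult: "s u = (- lform (s u) v) *\<^sub>R \<sigma> u" "lform (s u) v \<noteq> 0"
    "dd X s u = (- lform (s u) v) *\<^sub>R dd X \<sigma> u - lform (dd X s u) v *\<^sub>R \<sigma> u"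
    if "u \<in> W" for u X
    using section_multiple(1,2)[OF s, of u] section_multiple(3)[OF s, of u X] that by (auto simp: W_def)
  have V: "u \<in> V" if "u \<in> W" for u using that by (simp add: W_def)
  have ss: "lform (s u) (s u) = 0" if "u \<in> W" for u
    by (subst (1 2) mult(1)[OF that]) (simp add: lform_simps null V that)
  have sds: "lform (s u) (dd X s u) = 0" if "u \<in> W" for u X
    using dd_lform_const[OF W(1) that ds[OF that] ds[OF that] ss, of X] that
    by (simp add: lform_sym[of "dd X s u"])
  have Ns: "lform (N u) (s u) = 0" if "u \<in> W" for u
    by (subst mult(1)[OF that]) (simp add: lform_simps N_lift V that)
  have Nds: "lform (N u) (dd X s u) = 0" if "u \<in> W" for u X
    by (subst mult(3)[OF that]) (simp add: lform_simps N_lift N_dd V that)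
  have sdds: "lform (s w) (dd Y (dd X s) w) = - lform (dd Y s w) (dd X s w)" for X Y
    using dd_lform_const[OF W ds[OF W(2)] dds[OF W(2)] sds[where X = X], of Y]
    by (simp add: add_eq_0_iff2)
  define f where "f = - lform (s w) v"
  have dNds: "lform (dd Y N w) (dd X s w) = f * lform (dd Y N w) (dd X \<sigma> w)" for X Y
    by (subst mult(3)[OF W(2)]) (simp add: lform_simps f_def dN_lift w)
  have Ndds: "lform (N w) (dd Y (dd X s) w) = - (f * lform (dd Y N w) (dd X \<sigma> w))" for X Y
    using dd_lform_const[OF W N_differentiable[OF w(1)] dds[OF W(2)] Nds[where X = X], of Y]
    by (simp add: dNds add_eq_0_iff2)
  have f0: "f \<noteq> 0" using mult(2)[OF W(2)] by (simp add: f_def)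
  define e where "e = lform (dd 1 s w) (dd 1 s w)"
  have e0: "e \<noteq> 0"
    using section_metric[OF s w, of 1 1] metric_pos[OF w(1)] f0 by (simp add: e_def f_def)
  have e1: "lform (dd \<i> s w) (dd \<i> s w) = e" "lform (dd 1 s w) (dd \<i> s w) = 0"
    "lform (dd \<i> s w) (dd 1 s w) = 0"
    using section_metric[OF s w] conformal_equal[OF w(1)] conformal_orthogonal[OF w(1)]
    by (simp_all add: e_def lform_sym[of "dd \<i> \<sigma> w" "dd 1 \<sigma> w"])
  define L where "L = (1 / 4) *s cvec (dd 1 (dd 1 s) w + dd \<i> (dd \<i> s) w) +
    (\<i> / 4) *s cvec (dd \<i> (dd 1 s) w - dd 1 (dd \<i> s) w)"
  show ?thesis
    unfolding Let_def dz_cvec[OF ds[OF W(2)]] dzbar_dz_cvec[OF W sm] L_def[symmetric]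
  proof (rule frame_span)
    \<comment> \<open>The commutator term drops out and the value is \<open>- e / 2\<close>, by
      differentiating \<open>(s, ds) = 0\<close>.\<close>
    show "lform (cvec (s w)) L \<noteq> 0"
      using e0 by (simp add: L_def lform_simps lform_cvec sdds e1 e_def[symmetric])
    \<comment> \<open>Up to a real factor, the real part is the trace and the imaginary part the
      antisymmetric part of the second fundamental form.\<close>
    show "lform L (cvec (N w)) = 0"
      using h_sym[OF w(1)] h_trace[OF w(1)]
      by (simp add: L_def lform_sym[of _ "cvec (N w)"] lform_simps lform_cvec Ndds add_eq_0_iff)
  qed (simp_all add: lform_simps lform_cvec ss sds W Ns Nds e1 e_def[symmetric] e0
      N_unit w lform_sym[of "s w" "N w"] lform_sym[of "dd X s w" "N w" for X])
qed

lemma csc_eq: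
  assumes "w \<in> V"
  shows "csc \<Lambda> w = {x. lform x (cvec (N w)) = 0}"
proof -
  have "csc \<Lambda> w = (\<Union>s \<in> {s. \<exists>V. w \<in> V \<and> nz_section V \<Lambda> s}. {x. lform x (cvec (N w)) = 0})"
    unfolding csc_def by (rule SUP_cong) (use section_frame_span assms in auto)
  also have "\<dots> = {x. lform x (cvec (N w)) = 0}"
    \<comment> \<open>The lift is itself such a section, so the union is not over an empty
      family.\<close>
    using nz_section_lift assms by auto
  finally show ?thesis .
qed

lemma oproj_csc:
  assumes "w \<in> V"
  shows "oproj (csc \<Lambda> w) x = x - lform x (cvec (N w)) *s cvec (N w)"
    and "oproj (perp (csc \<Lambda> w)) x = lform x (cvec (N w)) *s cvec (N w)"
  using oproj_hyperplane[of "cvec (N w)"] by (simp_all add: csc_eq assms lform_cvec N_unit)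

text \<open>With \<open>p\<close> the normal part of \<open>g\<close>, the connection is the
  tangential part of \<open>d(g - p)\<close> plus the normal part of \<open>dp\<close>. Both are
  explicit because \<open>dN\<close> is orthogonal to \<open>N\<close>.\<close>

lemma Dconn_csc:
  assumes g: "smooth_on V g" and w: "w \<in> V"
  shows "Dconn (csc \<Lambda>) X (\<lambda>u. cvec (g u)) w =
    cvec (dd X g w - lform (g w) (N w) *\<^sub>R dd X N w + lform (g w) (dd X N w) *\<^sub>R N w)"
proof -
  define p where "p u = lform (g u) (N u) *\<^sub>R N u" for u
  note dg = smooth_on_differentiable[OF g open_V w]
  note dN = N_differentiable[OF w]
  have pd: "p differentiable (at w)"
    and p: "dd X p w = lform (g w) (N w) *\<^sub>R dd X N w +
      (lform (g w) (dd X N w) + lform (dd X g w) (N w)) *\<^sub>R N w"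
    using dd_scaleR[OF dd_lform(2)[OF dg dN] dN] dd_lform(1)[OF dg dN]
    by (auto simp: p_def[abs_def])
  have gpd: "(\<lambda>u. g u - p u) differentiable (at w)" using dg pd by (rule differentiable_diff)
  have cd: "(\<lambda>u. cvec (k u)) differentiable (at w)" if "k differentiable (at w)" for k
    using dd_bounded_linear(2)[OF bounded_linear_cvec that] .
  have 1: "dd X (\<lambda>u. oproj (csc \<Lambda> u) (cvec (g u))) w = cvec (dd X g w - dd X p w)"
    by (subst dd_cong(1)[OF cd[OF gpd] open_V w])
      (simp_all only: dd_cvec[OF gpd] dd_diff[OF dg pd],
        simp add: oproj_csc p_def lform_cvec cvec_diff cvec_scaleR)
  have 2: "dd X (\<lambda>u. oproj (perp (csc \<Lambda> u)) (cvec (g u))) w = cvec (dd X p w)"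
    by (subst dd_cong(1)[OF cd[OF pd] open_V w])
      (simp_all only: dd_cvec[OF pd], simp add: oproj_csc p_def lform_cvec cvec_scaleR)
  show ?thesis
    unfolding Dconn_def 1 2 oproj_csc[OF w] lform_cvec
    by (simp add: p lform_simps dN_N[OF w] N_unit[OF w] flip: cvec_scaleR cvec_diff cvec_add)
      (simp add: algebra_simps)
qed

lemma Nform_csc:
  assumes g: "smooth_on V g" and w: "w \<in> V"
  shows "Nform (csc \<Lambda>) X (\<lambda>u. cvec (g u)) w =
    cvec (lform (g w) (N w) *\<^sub>R dd X N w - lform (g w) (dd X N w) *\<^sub>R N w)"
  unfolding Nform_def Dconn_csc[OF assms] dd_cvec[OF smooth_on_differentiable[OF g open_V w]]
  by (simp flip: cvec_diff)

end

text \<open>Here \<open>1 / l = cnj l\<close>. Multiplying the argument by \<open>cnj l\<close>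
  multiplies a (1,0)-form by \<open>cnj l\<close> and a (0,1)-form by \<open>l\<close>, so the
  weighted sum is the form at the rotated vector, and it is again real.\<close>

lemma rotate_parts:
  assumes A: "linear A" and \<omega>: "\<And>Y. \<omega> Y f w = cvec (A Y)" and l: "norm l = 1"
  shows "(1 / l) *s part10 \<omega> X f w + l *s part01 \<omega> X f w = cvec (A (cnj l * X))"
proof -
  have "cnj l * X = Re l *\<^sub>R X + (- Im l) *\<^sub>R (\<i> * X)" by (simp add: complex_eq_iff)
  then have "A (cnj l * X) = Re l *\<^sub>R A X - Im l *\<^sub>R A (\<i> * X)"
    by (simp only: linear_add[OF A] linear_scale[OF A]) simp
  then have 1: "cvec (A (cnj l * X)) =
      complex_of_real (Re l) *s cvec (A X) - complex_of_real (Im l) *s cvec (A (\<i> * X))"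
    by (simp add: cvec_diff cvec_scaleR)
  have 2: "1 / l = cnj l"
    using l by (simp add: divide_conv_cnj)
  have 3: "complex_of_real (Re l) = (l + cnj l) / 2" "complex_of_real (Im l) = (l - cnj l) / (2 * \<i>)"
    by (simp_all add: complex_eq_iff)
  show ?thesis
    unfolding 1 2 3 part10_def part01_def \<omega>
    by (simp add: vec_eq_iff field_simps)
qed

lemma part10_plus_part01: "part10 \<omega> X f w + part01 \<omega> X f w = \<omega> X f w"
  by (simp add: part10_def part01_def vec_eq_iff field_simps)

text \<open>Converse to \<open>section_frame_span\<close>: orthogonality of \<open>N\<close> to
  \<open>dzbar (dz \<sigma>)\<close> has the vanishing trace as its real part and the symmetry as
  its imaginary part.\<close>

lemma (in normalized_lift) framed_lift_of_perp_csc: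
  assumes sN: "smooth_on V N" and N1: "\<And>w. w \<in> V \<Longrightarrow> lform (N w) (N w) = 1"
    and perp: "\<And>w. w \<in> V \<Longrightarrow> cvec (N w) \<in> perp (csc \<Lambda> w)"
  shows "framed_lift V \<Lambda> \<sigma> v N"
proof -
  note dN = smooth_on_differentiable[OF sN open_V]
  note dds = smooth_on_differentiable[OF smooth_on_dd[OF smooth] open_V]
  have in_csc: "vec.span {cvec (\<sigma> w), dz (\<lambda>u. cvec (\<sigma> u)) w, dzbar (\<lambda>u. cvec (\<sigma> u)) w,
      dzbar (dz (\<lambda>u. cvec (\<sigma> u))) w} \<subseteq> csc \<Lambda> w" if "w \<in> V" for w
    using nz_section_lift that unfolding csc_def Let_def by blast
  have orth: "lform (cvec (N w)) x = 0"
    if "w \<in> V" "x \<in> {cvec (\<sigma> w), dz (\<lambda>u. cvec (\<sigma> u)) w, dzbar (\<lambda>u. cvec (\<sigma> u)) w,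
      dzbar (dz (\<lambda>u. cvec (\<sigma> u))) w}" for w x
    using perp[OF that(1)] in_csc[OF that(1)] vec.span_base[OF that(2)] by (auto simp: perp_def)
  have N\<sigma>: "lform (N w) (\<sigma> w) = 0" if "w \<in> V" for w
    using orth[OF that, of "cvec (\<sigma> w)"] by (simp add: lform_cvec)
  have Nd: "lform (N w) (dd X \<sigma> w) = 0" if "w \<in> V" for w X
  proof -
    have "lform (N w) (dd 1 \<sigma> w) = 0 \<and> lform (N w) (dd \<i> \<sigma> w) = 0"
      using orth[OF that, of "dz (\<lambda>u. cvec (\<sigma> u)) w"]
      by (simp add: dz_cvec[OF differentiable[OF that]] lform_simps lform_cvec complex_eq_iff)
    then show ?thesis
      by (subst linear_dd_complex[OF differentiable[OF that]]) (simp add: lform_simps)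
  qed
  have Ndd: "lform (N w) (dd Y (dd X \<sigma>) w) = - lform (dd Y N w) (dd X \<sigma> w)" if "w \<in> V" for w X Y
    using dd_lform_const[OF open_V that dN[OF that] dds[OF that] Nd[where X = X], of Y]
    by (simp add: add_eq_0_iff2)
  have h: "lform (N w) (dd 1 (dd 1 \<sigma>) w) + lform (N w) (dd \<i> (dd \<i> \<sigma>) w) = 0"
    "lform (N w) (dd \<i> (dd 1 \<sigma>) w) = lform (N w) (dd 1 (dd \<i> \<sigma>) w)" if "w \<in> V" for w
    using orth[OF that, of "dzbar (dz (\<lambda>u. cvec (\<sigma> u))) w"]
    by (simp_all add: dzbar_dz_cvec[OF open_V that smooth] lform_simps lform_cvec complex_eq_iff)
  have h': "lform (dd 1 N w) (dd 1 \<sigma> w) + lform (dd \<i> N w) (dd \<i> \<sigma> w) = 0"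
    "lform (dd \<i> N w) (dd 1 \<sigma> w) = lform (dd 1 N w) (dd \<i> \<sigma> w)" if "w \<in> V" for w
    using h[OF that] by (simp_all add: Ndd[OF that])
  show ?thesis
    by unfold_locales (simp_all add: sN N1 N\<sigma> Nd h')
qed

text \<open>Two derivatives of \<open>(\<sigma>, n) = 0\<close> place the central sphere in the
  complement of \<open>n\<close>, so \<open>n = g N\<close> with \<open>g = (n, N)\<close> never
  zero. Then \<open>dg = (n, dN) = g (N, dN) = 0\<close>, and differentiating \<open>n = g N\<close>
  leaves \<open>g dN = 0\<close>.\<close>

lemma (in framed_lift) dN_zero_of_sphere:
  assumes n: "lform n n \<noteq> 0" "\<And>w. w \<in> V \<Longrightarrow> lform (\<sigma> w) n = 0" and w: "w \<in> V"
  shows "dd X N w = 0"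
proof -
  note dds = smooth_on_differentiable[OF smooth_on_dd[OF smooth] open_V]
  have 1: "lform (dd X \<sigma> w) n = 0" if "w \<in> V" for w X
    using dd_lform_const[OF open_V that differentiable[OF that] differentiable_const n(2)]
    by (simp add: lform_simps)
  have 2: "lform (dd Y (dd X \<sigma>) w) n = 0" if "w \<in> V" for w X Y
    using dd_lform_const[OF open_V that dds[OF that] differentiable_const 1[where X = X]]
    by (simp add: lform_simps)
  have eq: "n = lform n (N w) *\<^sub>R N w" if "w \<in> V" for w
  proof -
    have "vec.span {cvec (\<sigma> w), dz (\<lambda>u. cvec (\<sigma> u)) w, dzbar (\<lambda>u. cvec (\<sigma> u)) w,
      dzbar (dz (\<lambda>u. cvec (\<sigma> u))) w} \<subseteq> {x. lform x (cvec n) = 0}"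
    proof (rule vec.span_minimal)
      show "vec.subspace {x. lform x (cvec n) = 0}"
        by (auto simp: vec.subspace_def lform_simps)
    qed (simp add: dz_cvec[OF differentiable[OF that]] dzbar_dz_cvec[OF open_V that smooth]
        lform_simps lform_cvec n(2) 1 2 that)
    then have "cvec n \<in> perp {x. lform x (cvec (N w)) = 0}"
      using section_frame_span[OF nz_section_lift that that]
      by (auto simp: perp_def Let_def lform_sym[of "cvec n"])
    then have "cvec n = cvec (lform n (N w) *\<^sub>R N w)"
      using perp_hyperplane[of "cvec (N w)"] N_unit[OF that] by (simp add: lform_cvec cvec_scaleR)
    then show ?thesis by simp
  qed
  define g where "g w = lform n (N w)" for w
  have g0: "g w \<noteq> 0" using eq[OF w] n(1) by (auto simp: g_def lform_simps)
  have dg: "g differentiable (at w)" "dd X g w = lform n (dd X N w)"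
    using dd_lform[OF differentiable_const[where a = n] N_differentiable[OF w]]
    by (simp_all add: g_def[abs_def] lform_simps)
  have "lform n (dd X N w) = 0"
    by (subst eq[OF w]) (simp add: lform_simps lform_sym[of "N w"] dN_N[OF w])
  moreover have "dd X (\<lambda>u. n) w = dd X (\<lambda>u. g u *\<^sub>R N u) w"
    by (rule dd_cong(1)[OF dd_scaleR(2)[OF dg(1) N_differentiable[OF w]] open_V w])
      (use eq in \<open>simp add: g_def\<close>)
  ultimately have "g w *\<^sub>R dd X N w = 0"
    by (simp add: dd_scaleR(1)[OF dg(1) N_differentiable[OF w]] dg(2))
  with g0 show ?thesis by simp
qed

section \<open>The deformed surface\<close>

text \<open>\<open>q_eq\<close> is the form \<open>q_inf_t\<close> on real sections, written with
  real vectors; the minus sign before \<open>t\<close> is that of \<open>star\<close>.\<close>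

locale spectral_deformation = framed_lift +
  fixes H t :: real and l :: complex and q :: opform and \<phi> :: "complex \<Rightarrow> real ^ 5 ^ 5"
  assumes mean: "w \<in> V \<Longrightarrow> lform v (N w) = H"
    and norm_l: "norm l = 1"
    and q_eq: "w \<in> V \<Longrightarrow> q X (\<lambda>u. cvec (g u)) w = cvec ((1 / 2) *\<^sub>R
      (lform (g w) (\<sigma> w) *\<^sub>R (H *\<^sub>R dd X N w - t *\<^sub>R dd (\<i> * X) N w)
        - lform (g w) (H *\<^sub>R dd X N w - t *\<^sub>R dd (\<i> * X) N w) *\<^sub>R \<sigma> w))"
    and smooth_\<phi>: "smooth_on V \<phi>"
    and isometry: "w \<in> V \<Longrightarrow> is_isometry (\<phi> w)"
    and intertwines: "smooth_on V g \<Longrightarrow> w \<in> V \<Longrightarrow>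
      cmat (\<phi> w) *v spectral_connection (csc \<Lambda>) l q X (\<lambda>u. cvec (g u)) w
        = dd X (\<lambda>u. cvec (\<phi> u *v g u)) w"
begin

lemma \<phi>_lform: "w \<in> V \<Longrightarrow> lform (\<phi> w *v x) (\<phi> w *v y) = lform x y"
  using isometry by (auto simp: is_isometry_def)

lemma \<phi>_eq_0: "w \<in> V \<Longrightarrow> \<phi> w *v x = 0 \<Longrightarrow> x = 0"
  by (rule lform_nondegenerate) (metis \<phi>_lform lform_zero_left)

lemma smooth_\<phi>_image: "smooth_on V g \<Longrightarrow> smooth_on V (\<lambda>u. \<phi> u *v g u)"
  by (rule smooth_on_bounded_bilinear[OF bounded_bilinear_matrix_vector open_V smooth_\<phi>])

text \<open>\<open>rotate_parts\<close> is used with \<open>l\<close> for \<open>Nform\<close> and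
  with \<open>l\<^sup>2\<close> for \<open>q\<close>. The \<open>- 1\<close> in \<open>a\<close>
  comes from \<open>Dconn = d - Nform\<close>, the one in \<open>b\<close> from the weights of
  \<open>q\<close>.\<close>

lemma dd_\<phi>_image:
  fixes X :: complex
  assumes g: "smooth_on V g" and w: "w \<in> V"
  defines "a \<equiv> dd ((cnj l - 1) * X) N w"
    and "b \<equiv> dd ((H - \<i> * t) * ((cnj l)\<^sup>2 - 1) * X) N w"
  shows "dd X (\<lambda>u. \<phi> u *v g u) w = \<phi> w *v
    (dd X g w + lform (g w) (N w) *\<^sub>R a - lform (g w) a *\<^sub>R N w
      + (1 / 2) *\<^sub>R (lform (g w) (\<sigma> w) *\<^sub>R b - lform (g w) b *\<^sub>R \<sigma> w))"
proof -
  define n where "n Y = dd Y N w" for Y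
  have lin: "linear n" using dd_linear[OF N_differentiable[OF w]] by (simp add: n_def[abs_def])
  define A where "A Y = lform (g w) (N w) *\<^sub>R n Y - lform (g w) (n Y) *\<^sub>R N w" for Y
  define C where "C x = (1 / 2) *\<^sub>R (lform (g w) (\<sigma> w) *\<^sub>R x - lform (g w) x *\<^sub>R \<sigma> w)" for x
  \<comment> \<open>By real linearity of \<open>dN\<close>, multiplication by \<open>\<tau>\<close>
    encodes the two terms of \<open>q\<close> with \<open>H\<close> and \<open>t\<close> in one
    argument.\<close>
  define \<tau> where "\<tau> = complex_of_real H - \<i> * complex_of_real t"
  have n_\<tau>: "n (\<tau> * Y) = H *\<^sub>R n Y - t *\<^sub>R n (\<i> * Y)" for Y
  proof -
    have "\<tau> * Y = H *\<^sub>R Y - t *\<^sub>R (\<i> * Y)"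
      by (simp add: \<tau>_def scaleR_conv_of_real algebra_simps)
    then show ?thesis by (simp only: linear_diff[OF lin] linear_scale[OF lin])
  qed
  have linA: "linear A"
    by (rule linearI)
      (simp_all add: A_def linear_add[OF lin] linear_scale[OF lin] lform_simps algebra_simps)
  have linC: "linear C"
    by (rule linearI) (simp_all add: C_def lform_simps algebra_simps)
  have lin\<tau>: "linear (\<lambda>Y. n (\<tau> * Y))"
    by (rule linearI) (simp_all add: linear_add[OF lin] linear_scale[OF lin] ring_distribs)
  have linB: "linear (\<lambda>Y. C (n (\<tau> * Y)))"
    using linear_compose[OF lin\<tau> linC] by (simp add: o_def)
  have q: "q Y (\<lambda>u. cvec (g u)) w = cvec (C (n (\<tau> * Y)))" for Y
    unfolding q_eq[OF w] C_def n_\<tau> unfolding n_def ..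
  have Nf: "Nform (csc \<Lambda>) Y (\<lambda>u. cvec (g u)) w = cvec (A Y)" for Y
    unfolding Nform_csc[OF g w] A_def n_def ..
  have l2: "norm (l\<^sup>2) = 1" using norm_l by (simp add: norm_power)
  have a: "a = n (cnj l * X) - n X"
    unfolding a_def by (simp add: n_def[symmetric] linear_diff[OF lin, symmetric] ring_distribs)
  have b: "b = n (\<tau> * ((cnj l)\<^sup>2 * X)) - n (\<tau> * X)"
    unfolding b_def \<tau>_def
    by (simp add: n_def[symmetric] linear_diff[OF lin, symmetric] algebra_simps)
  \<comment> \<open>The weights \<open>1 / l\<^sup>2 - 1\<close> and \<open>l\<^sup>2 - 1\<close>
    are split so that \<open>rotate_parts\<close> applies, while the parts with weight
    \<open>- 1\<close> recombine to \<open>q\<close> itself.\<close>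
  have "spectral_connection (csc \<Lambda>) l q X (\<lambda>u. cvec (g u)) w =
    Dconn (csc \<Lambda>) X (\<lambda>u. cvec (g u)) w
    + ((1 / l) *s part10 (Nform (csc \<Lambda>)) X (\<lambda>u. cvec (g u)) w
        + l *s part01 (Nform (csc \<Lambda>)) X (\<lambda>u. cvec (g u)) w)
    + (((1 / l\<^sup>2) *s part10 q X (\<lambda>u. cvec (g u)) w + l\<^sup>2 *s part01 q X (\<lambda>u. cvec (g u)) w)
      - (part10 q X (\<lambda>u. cvec (g u)) w + part01 q X (\<lambda>u. cvec (g u)) w))"
    unfolding spectral_connection_def by (simp add: vec_eq_iff algebra_simps)
  also have "\<dots> = Dconn (csc \<Lambda>) X (\<lambda>u. cvec (g u)) w + cvec (A (cnj l * X))
      + (cvec (C (n (\<tau> * ((cnj l)\<^sup>2 * X)))) - cvec (C (n (\<tau> * X))))"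
    by (simp only: rotate_parts[where \<omega> = "Nform (csc \<Lambda>)" and f = "\<lambda>u. cvec (g u)" and w = w, OF linA Nf norm_l]
        rotate_parts[where \<omega> = q and f = "\<lambda>u. cvec (g u)" and w = w, OF linB q l2] part10_plus_part01 q complex_cnj_power)
  also have "\<dots> = cvec (dd X g w + lform (g w) (N w) *\<^sub>R a - lform (g w) a *\<^sub>R N w + C b)"
    unfolding Dconn_csc[OF g w] cvec_add[symmetric] cvec_diff[symmetric] cvec_inject
      a b linear_diff[OF linC]
    by (simp add: A_def n_def[symmetric] lform_simps algebra_simps)
  finally have "cvec (dd X (\<lambda>u. \<phi> u *v g u) w) =
      cvec (\<phi> w *v (dd X g w + lform (g w) (N w) *\<^sub>R a - lform (g w) a *\<^sub>R N w + C b))"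
    using intertwines[OF g w, of X] smooth_on_differentiable[OF smooth_\<phi>_image[OF g] open_V w]
    by (simp add: cmat_cvec dd_cvec)
  then show ?thesis by (simp add: C_def)
qed

text \<open>The correction terms pair \<open>\<sigma>\<close> with \<open>N\<close>, with values of
  \<open>dN\<close> or with itself, and all these products vanish.\<close>

lemma dd_\<phi>_lift: "w \<in> V \<Longrightarrow> dd X (\<lambda>u. \<phi> u *v \<sigma> u) w = \<phi> w *v dd X \<sigma> w"
  by (simp add: dd_\<phi>_image smooth N_lift null lform_sym[of "\<sigma> w" "N w"]
      lform_sym[of "\<sigma> w" "dd Y N w" for Y] dN_lift)

text \<open>Only the correction with \<open>(N, N) = 1\<close> survives, and it replaces
  \<open>X\<close> by \<open>cnj l * X\<close> in \<open>dN\<close>.\<close>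

lemma dd_\<phi>_N:
  assumes w: "w \<in> V"
  shows "dd X (\<lambda>u. \<phi> u *v N u) w = \<phi> w *v dd (cnj l * X) N w"
proof -
  have "dd ((cnj l - 1) * X) N w = dd (cnj l * X) N w - dd X N w"
    by (simp add: linear_diff[OF dd_linear[OF N_differentiable[OF w]], symmetric] ring_distribs)
  then show ?thesis
    by (simp add: dd_\<phi>_image smooth_N w N_lift N_unit lform_sym[of "N w" "dd Y N w" for Y] dN_N lform_simps)
qed

text \<open>Since \<open>l - 1 / l = 2 * \<i> * Im l\<close> on the unit circle, this is the
  coefficient of \<open>N\<close> in \<open>v_spectral\<close>.\<close>

definition \<mu> :: real where
  "\<mu> = Re l * H - t * Im l"

text \<open>As \<open>v\<close> has normal part \<open>H N\<close>, this is the tangential part of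
  \<open>v\<close> plus \<open>\<mu> N\<close>.\<close>

definition v_shift :: "complex \<Rightarrow> real ^ 5" where
  "v_shift w = v + (\<mu> - H) *\<^sub>R N w"

lemma smooth_v_shift: "smooth_on V v_shift"
  unfolding v_shift_def[abs_def]
  by (intro smooth_on_add smooth_on_bounded_bilinear[OF bounded_bilinear_scaleR] open_V smooth_N
      smooth_on_const)

text \<open>Constancy of the mean curvature enters here: \<open>(v, N) = H\<close> is
  differentiated.\<close>

lemma dN_v:
  assumes w: "w \<in> V"
  shows "lform v (dd X N w) = 0"
  using dd_lform_const[OF open_V w differentiable_const N_differentiable[OF w] mean, of X]
  by (simp add: lform_simps)

text \<open>The terms along \<open>N\<close> and \<open>\<sigma>\<close> vanish, and real linearity
  collects the rest into \<open>dN\<close> of a single vector. That vector is zero by the choice of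
  \<open>\<mu>\<close>.\<close>

lemma dd_\<phi>_v_shift:
  assumes w: "w \<in> V"
  shows "dd X (\<lambda>x. \<phi> x *v v_shift x) w = 0"
proof -
  note dN = N_differentiable[OF w]
  define n where "n Y = dd Y N w" for Y
  have lin: "linear n" using dd_linear[OF dN] by (simp add: n_def[abs_def])
  have du: "dd X v_shift w = (\<mu> - H) *\<^sub>R n X"
    unfolding v_shift_def[abs_def] n_def
    using dd_add[OF differentiable_const dd_bounded_linear(2)[OF bounded_linear_scaleR_right dN], of X v]
    by (simp add: dd_bounded_linear(1)[OF bounded_linear_scaleR_right dN])
  have u: "lform (v_shift w) (N w) = \<mu>" "lform (v_shift w) (n Y) = 0" "lform (v_shift w) (\<sigma> w) = - 1" for Y
    using normalized[OF w] mean[OF w] dN_v[OF w, of Y] N_unit[OF w] N_lift[OF w] dN_N[OF w, of Y]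
    by (simp_all add: v_shift_def n_def lform_simps lform_sym[of v "\<sigma> w"] lform_sym[of "N w" "dd Y N w"])
  have l1: "l * cnj l = 1"
    using norm_l by (simp add: complex_norm_square[symmetric])
  have l2: "complex_of_real \<mu> = (l + cnj l) / 2 * H + \<i> * t * (l - cnj l) / 2"
    by (simp add: \<mu>_def complex_eq_iff)
  have z: "(\<mu> - H) *\<^sub>R X + \<mu> *\<^sub>R ((cnj l - 1) * X)
      - (1 / 2) *\<^sub>R ((H - \<i> * t) * ((cnj l)\<^sup>2 - 1) * X) = 0"
  proof -
    \<comment> \<open>Multiplication by \<open>cnj l\<close> together with
      \<open>l * cnj l = 1\<close> makes this a polynomial in \<open>cnj l\<close>, which cancels
      against the contribution of \<open>q\<close>.\<close>
    have "complex_of_real \<mu> * cnj l =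
        (l * cnj l + (cnj l)\<^sup>2) / 2 * H + \<i> * t * (l * cnj l - (cnj l)\<^sup>2) / 2"
      unfolding l2 by (simp add: field_simps power2_eq_square)
    then have "complex_of_real \<mu> * cnj l = (1 + (cnj l)\<^sup>2) / 2 * H + \<i> * t * (1 - (cnj l)\<^sup>2) / 2"
      unfolding l1 .
    then have "(complex_of_real \<mu> - H) + complex_of_real \<mu> * (cnj l - 1)
        - (1 / 2) * ((H - \<i> * t) * ((cnj l)\<^sup>2 - 1)) = 0"
      by (simp add: right_diff_distrib) (simp add: field_simps)
    then have "((complex_of_real \<mu> - H) + complex_of_real \<mu> * (cnj l - 1)
        - (1 / 2) * ((H - \<i> * t) * ((cnj l)\<^sup>2 - 1))) * X = 0"
      by simp
    then show ?thesis
      by (simp add: scaleR_conv_of_real algebra_simps)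
  qed
  have "dd X (\<lambda>x. \<phi> x *v v_shift x) w = \<phi> w *v ((\<mu> - H) *\<^sub>R n X + \<mu> *\<^sub>R n ((cnj l - 1) * X)
      - (1 / 2) *\<^sub>R n ((H - \<i> * t) * ((cnj l)\<^sup>2 - 1) * X))"
    by (simp add: dd_\<phi>_image[OF smooth_v_shift w] du n_def[symmetric] u)
  also have "\<dots> = \<phi> w *v n ((\<mu> - H) *\<^sub>R X + \<mu> *\<^sub>R ((cnj l - 1) * X)
      - (1 / 2) *\<^sub>R ((H - \<i> * t) * ((cnj l)\<^sup>2 - 1) * X))"
    by (simp only: linear_add[OF lin] linear_diff[OF lin] linear_scale[OF lin])
  also have "\<dots> = 0" unfolding z by (simp add: linear_0[OF lin])
  finally show ?thesis .
qed

text \<open>As \<open>\<phi>\<close> is isometric and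
  \<open>d(\<phi>\<sigma>) = \<phi> d\<sigma>\<close>, the conditions on the lift carry over; the
  work lies in those on the derivative of the normal.\<close>

lemma framed_lift_\<phi>:
  assumes v': "\<And>w. w \<in> V \<Longrightarrow> \<phi> w *v v_shift w = v'"
  shows "framed_lift V (\<lambda>w. (\<lambda>x. \<phi> w *v x) ` \<Lambda> w) (\<lambda>w. \<phi> w *v \<sigma> w) v' (\<lambda>w. \<phi> w *v N w)"
proof
  have span: "(\<lambda>x. \<phi> w *v x) ` span {y} = span {\<phi> w *v y}" for w y
    using linear_span_image[OF matrix_vector_mul_linear, of "\<phi> w" "{y}"] by simp
  fix w X Y assume w: "w \<in> V"
  show "(\<lambda>x. \<phi> w *v x) ` \<Lambda> w = span {\<phi> w *v \<sigma> w}" by (simp add: line w span)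
  show "lform (\<phi> w *v \<sigma> w) v' = - 1"
    using normalized[OF w] N_lift[OF w]
    by (simp add: v'[OF w, symmetric] \<phi>_lform w) (simp add: v_shift_def lform_simps lform_sym[of "\<sigma> w" "N w"])
  show "dd X (\<lambda>w. \<phi> w *v \<sigma> w) w \<notin> span {\<phi> w *v \<sigma> w}" if "X \<noteq> 0"
  proof
    assume "dd X (\<lambda>w. \<phi> w *v \<sigma> w) w \<in> span {\<phi> w *v \<sigma> w}"
    then obtain y where y: "y \<in> span {\<sigma> w}" "\<phi> w *v dd X \<sigma> w = \<phi> w *v y"
      by (auto simp: dd_\<phi>_lift w span[symmetric])
    then have "\<phi> w *v (dd X \<sigma> w - y) = 0" by (simp add: matrix_vector_mult_diff_distrib)
    with \<phi>_eq_0[OF w] y(1) immersion[OF w that] show False by fastforce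
  qed
  \<comment> \<open>Rotating \<open>dN\<close> only mixes the trace and the antisymmetric part of
    the second fundamental form, so both still vanish.\<close>
  have hat: "dd (cnj l * \<i>) N w = Im l *\<^sub>R dd 1 N w + Re l *\<^sub>R dd \<i> N w"
    "dd (cnj l * 1) N w = Re l *\<^sub>R dd 1 N w - Im l *\<^sub>R dd \<i> N w"
    by (subst linear_dd_complex[OF N_differentiable[OF w]]; simp)+
  note h = h_trace[OF w] h_sym[OF w]
  show "lform (dd \<i> (\<lambda>w. \<phi> w *v N w) w) (dd 1 (\<lambda>w. \<phi> w *v \<sigma> w) w) =
      lform (dd 1 (\<lambda>w. \<phi> w *v N w) w) (dd \<i> (\<lambda>w. \<phi> w *v \<sigma> w) w)"
    unfolding dd_\<phi>_N[OF w] dd_\<phi>_lift[OF w] \<phi>_lform[OF w] hat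
    using h by (simp add: lform_simps add_eq_0_iff2)
  show "lform (dd 1 (\<lambda>w. \<phi> w *v N w) w) (dd 1 (\<lambda>w. \<phi> w *v \<sigma> w) w) +
      lform (dd \<i> (\<lambda>w. \<phi> w *v N w) w) (dd \<i> (\<lambda>w. \<phi> w *v \<sigma> w) w) = 0"
    unfolding dd_\<phi>_N[OF w] dd_\<phi>_lift[OF w] \<phi>_lform[OF w] hat
    using h by (simp add: lform_simps add_eq_0_iff2)
qed (simp_all add: open_V smooth_\<phi>_image smooth smooth_N dd_\<phi>_lift \<phi>_lform null conformal
    N_unit N_lift N_dd)

end

section \<open>From charts to the surface\<close>

lemma inv_chart_in_topspace:
  assumes "is_chart M c" "w \<in> chart_image c"
  shows "inv_into (fst c) (snd c) w \<in> topspace M"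
proof -
  have "inv_into (fst c) (snd c) w \<in> fst c"
    using assms(2) by (auto simp: chart_image_def inv_into_into)
  moreover have "fst c \<subseteq> topspace M"
    using assms(1) by (auto simp: is_chart_def dest: openin_subset)
  ultimately show ?thesis by blast
qed

lemma in_chart_apply:
  assumes "is_chart M c" "p \<in> fst c"
  shows "snd c p \<in> chart_image c" "in_chart c f (snd c p) = f p"
proof -
  have "fst c \<subseteq> topspace M" "inj_on (snd c) (topspace (subtopology M (fst c)))"
    using assms(1) unfolding is_chart_def
    by (blast dest: openin_subset, blast intro: homeomorphic_imp_injective_map)
  then have "inj_on (snd c) (fst c)"
    by (simp add: Int_absorb1)
  then show "snd c p \<in> chart_image c" "in_chart c f (snd c p) = f p"
    using assms(2) by (auto simp: chart_image_def in_chart_def)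
qed

lemma openin_chart_preimage:
  assumes "is_chart M c" "open B"
  shows "openin M {p \<in> fst c. snd c p \<in> B}"
proof -
  have c: "openin M (fst c)" "homeomorphic_map (subtopology M (fst c)) (top_of_set (chart_image c)) (snd c)"
    using assms(1) by (auto simp: is_chart_def)
  have "continuous_map (subtopology M (fst c)) (top_of_set (chart_image c)) (snd c)"
    using c(2) by (rule homeomorphic_imp_continuous_map)
  moreover have "openin (top_of_set (chart_image c)) (chart_image c \<inter> B)"
    using assms(2) by (auto simp: openin_open)
  ultimately have opn: "openin (subtopology M (fst c))
      {p \<in> topspace (subtopology M (fst c)). snd c p \<in> chart_image c \<inter> B}"
    by (rule openin_continuous_map_preimage)
  have eq: "{p \<in> topspace (subtopology M (fst c)). snd c p \<in> chart_image c \<inter> B}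
      = {p \<in> fst c. snd c p \<in> B}"
    using openin_subset[OF c(1)] by (auto simp: chart_image_def)
  show ?thesis
    using openin_trans_full[OF opn c(1)] unfolding eq .
qed

lemma oriented_surface_chart:
  assumes "oriented_surface M \<A>" "p \<in> topspace M"
  obtains c where "c \<in> \<A>" "p \<in> fst c" "is_chart M c"
proof -
  have "p \<in> (\<Union>c\<in>\<A>. fst c)" using assms unfolding oriented_surface_def by simp
  moreover have "\<forall>c\<in>\<A>. is_chart M c" using assms unfolding oriented_surface_def by simp
  ultimately show thesis using that by blast
qed

text \<open>On balls inside charts \<open>F\<close> is constant; connectedness of the surface does
  the rest.\<close>

lemma oriented_surface_constant:
  fixes F :: "'m \<Rightarrow> 'b::real_normed_vector"
  assumes M: "oriented_surface M \<A>"
    and diff: "\<And>c w. c \<in> \<A> \<Longrightarrow> w \<in> chart_image c \<Longrightarrow> in_chart c F differentiable (at w)"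
    and zero: "\<And>c w X. c \<in> \<A> \<Longrightarrow> w \<in> chart_image c \<Longrightarrow> dd X (in_chart c F) w = 0"
  shows "\<exists>k. \<forall>p\<in>topspace M. F p = k"
proof -
  have conn: "connected_space M" using M by (simp add: oriented_surface_def)
  have nbhd: "\<exists>U. openin M U \<and> p \<in> U \<and> (\<forall>x\<in>U. F x = F p)" if "p \<in> topspace M" for p
  proof -
    obtain c where c: "p \<in> fst c" "c \<in> \<A>" and ch: "is_chart M c"
      using oriented_surface_chart[OF M \<open>p \<in> topspace M\<close>] by metis
    have "open (chart_image c)" using ch by (simp add: is_chart_def)
    then obtain e where e: "e > 0" "ball (snd c p) e \<subseteq> chart_image c"
      using in_chart_apply(1)[OF ch c(1)] by (metis openE)
    have "\<exists>k. \<forall>w\<in>ball (snd c p) e. in_chart c F w = k"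
    proof (rule has_derivative_zero_constant[OF convex_ball])
      fix w assume "w \<in> ball (snd c p) e"
      with e have w: "w \<in> chart_image c" by blast
      show "(in_chart c F has_derivative (\<lambda>h. 0)) (at w within ball (snd c p) e)"
        using differentiable_imp_dd[OF diff[OF c(2) w]] zero[OF c(2) w]
        by (auto intro: has_derivative_at_withinI)
    qed
    then obtain k where k: "\<And>w. w \<in> ball (snd c p) e \<Longrightarrow> in_chart c F w = k" by blast
    have Fk: "F x = k" if "x \<in> fst c" "snd c x \<in> ball (snd c p) e" for x
      using k[OF that(2)] in_chart_apply(2)[OF ch that(1), of F] by simp
    show ?thesis
    proof (intro exI conjI ballI)
      show "openin M {x \<in> fst c. snd c x \<in> ball (snd c p) e}"
        by (rule openin_chart_preimage[OF ch open_ball])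
      show "p \<in> {x \<in> fst c. snd c x \<in> ball (snd c p) e}" using c(1) e(1) by simp
      fix x assume "x \<in> {x \<in> fst c. snd c x \<in> ball (snd c p) e}"
      then show "F x = F p" using Fk[of x] Fk[of p] c(1) e(1) by simp
    qed
  qed
  \<comment> \<open>A general predicate makes both a fibre and its complement open.\<close>
  have open_fibre: "openin M {p \<in> topspace M. P (F p)}" for P
  proof (subst openin_subopen, intro ballI)
    fix p assume p: "p \<in> {p \<in> topspace M. P (F p)}"
    then have "p \<in> topspace M" by simp
    from nbhd[OF this] obtain U where U: "openin M U" "p \<in> U" "\<And>x. x \<in> U \<Longrightarrow> F x = F p" by blast
    have "U \<subseteq> {p \<in> topspace M. P (F p)}"
    proof
      fix x assume x: "x \<in> U"
      with openin_subset[OF U(1)] have "x \<in> topspace M" by blast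
      with U(3)[OF x] p show "x \<in> {p \<in> topspace M. P (F p)}" by simp
    qed
    with U(1,2) show "\<exists>T. openin M T \<and> p \<in> T \<and> T \<subseteq> {p \<in> topspace M. P (F p)}" by blast
  qed
  have "topspace M \<noteq> {}" using M unfolding oriented_surface_def by blast
  then obtain p0 where p0: "p0 \<in> topspace M" by blast
  have "F p = F p0" if "p \<in> topspace M" for p
  proof (rule ccontr)
    assume "F p \<noteq> F p0"
    then show False
      using connected_spaceD[OF conn open_fibre[of "\<lambda>x. x = F p0"] open_fibre[of "\<lambda>x. x \<noteq> F p0"]]
        p0 that by blast
  qed
  then show ?thesis by blast
qed

text \<open>The formula has degree zero in the vector, so the choice made by \<open>SOME\<close>
  does not matter. If \<open>(x, v) = 0\<close>, both sides are zero by
  \<open>inverse 0 = 0\<close>.\<close>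

lemma sigma_inf_span:
  assumes "\<Lambda> p = span {x}" "x \<noteq> 0"
  shows "sigma_inf \<Lambda> v p = (- inverse (lform x v)) *\<^sub>R x"
proof -
  define s where "s = (SOME s. s \<in> \<Lambda> p \<and> s \<noteq> 0)"
  have "s \<in> \<Lambda> p \<and> s \<noteq> 0"
    unfolding s_def by (rule someI[of _ x]) (use assms in \<open>auto simp: span_base\<close>)
  then obtain r where "s = r *\<^sub>R x" "r \<noteq> 0" using assms by (auto simp: span_singleton)
  then have "(- 1 / lform s v) *\<^sub>R s = (- inverse (lform x v)) *\<^sub>R x"
    by (simp add: lform_simps field_simps)
  then show ?thesis unfolding sigma_inf_def s_def Let_def .
qed

lemma normalized_lift_in_chart:
  assumes surf: "conformal_surface M \<A> \<Lambda>"
    and sf: "\<And>p. p \<in> topspace M \<Longrightarrow> sigma_inf \<Lambda> v p \<in> space_form v"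
    and c: "c \<in> \<A>"
  shows "normalized_lift (chart_image c) (in_chart c \<Lambda>) (in_chart c (sigma_inf \<Lambda> v)) v"
proof -
  define V where "V = chart_image c"
  define \<sigma> where "\<sigma> = in_chart c (sigma_inf \<Lambda> v)"
  have ch: "is_chart M c" and nl: "null_line_subbundle V (in_chart c \<Lambda>)"
    and im: "immersive V (in_chart c \<Lambda>)" and co: "conformal_coordinate V (in_chart c \<Lambda>)"
    using surf c by (auto simp: conformal_surface_def oriented_surface_def V_def)
  have oV: "open V" using ch by (simp add: is_chart_def V_def)
  have \<sigma>: "lform (\<sigma> w) (\<sigma> w) = 0" "lform (\<sigma> w) v = - 1" "\<sigma> w \<noteq> 0" if w: "w \<in> V" for w
  proof -
    from sf[OF inv_chart_in_topspace[OF ch w[unfolded V_def]]] show "lform (\<sigma> w) (\<sigma> w) = 0" "lform (\<sigma> w) v = - 1" "\<sigma> w \<noteq> 0"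
      by (auto simp: space_form_def lightcone_def \<sigma>_def in_chart_def)
  qed
  have \<sigma>_eq: "\<sigma> w = (- inverse (lform x v)) *\<^sub>R x" "lform x v \<noteq> 0"
    if "w \<in> V" "in_chart c \<Lambda> w = span {x}" "x \<noteq> 0" for w x
  proof -
    show *: "\<sigma> w = (- inverse (lform x v)) *\<^sub>R x"
      using sigma_inf_span[of \<Lambda> "inv_into (fst c) (snd c) w" x v] that(2,3)
      by (simp add: \<sigma>_def in_chart_def)
    \<comment> \<open>Otherwise \<open>inverse 0 = 0\<close> would give
      \<open>\<sigma> w = 0\<close>, which is not in the light cone.\<close>
    show "lform x v \<noteq> 0" using \<sigma>(3)[OF that(1)] * by auto
  qed
  have line: "in_chart c \<Lambda> w = span {\<sigma> w}" if w: "w \<in> V" for w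
  proof -
    obtain x where x: "in_chart c \<Lambda> w = span {x}" "x \<noteq> 0"
      using nl w unfolding null_line_subbundle_def lightcone_def by blast
    show ?thesis
      using \<sigma>_eq[OF w x] x(1) span_image_scale[of "{x}" "\<lambda>_. - inverse (lform x v)"] by simp
  qed
  \<comment> \<open>Near each point \<open>\<sigma>\<close> is a smooth local section divided by a
    smooth non-zero function.\<close>
  have smooth: "smooth_on V \<sigma>"
  proof (rule smooth_on_local[OF oV])
    fix w assume "w \<in> V"
    then have "\<exists>V' s. w \<in> V' \<and> V' \<subseteq> V \<and> nz_section V' (in_chart c \<Lambda>) s \<and>
        (\<forall>u\<in>V'. in_chart c \<Lambda> u = span {s u} \<and> s u \<in> lightcone)"
      using nl by (simp add: null_line_subbundle_def)
    then obtain V' s where V': "w \<in> V'" "V' \<subseteq> V" "nz_section V' (in_chart c \<Lambda>) s"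
      "\<forall>u\<in>V'. in_chart c \<Lambda> u = span {s u} \<and> s u \<in> lightcone"
      by blast
    have o: "open V'" and ss: "smooth_on V' s" using V'(3) by (auto simp: nz_section_def)
    have e: "\<sigma> u = (- 1 * inverse (lform (s u) v)) *\<^sub>R s u" "lform (s u) v \<noteq> 0" if "u \<in> V'" for u
      using \<sigma>_eq[of u "s u"] V'(2,4) that by (auto simp: lightcone_def)
    have "smooth_on V' (\<lambda>u. (- 1 * inverse (lform (s u) v)) *\<^sub>R s u)"
      using e(2)
      by (intro smooth_on_bounded_bilinear[OF bounded_bilinear_scaleR]
          smooth_on_bounded_bilinear[OF bounded_bilinear_mult]
          smooth_on_bounded_bilinear[OF bounded_bilinear_lform]
          smooth_on_inverse smooth_on_const o ss)
    then have "smooth_on V' \<sigma>" by (rule smooth_on_cong[OF o]) (simp add: e)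
    with o V'(1) show "\<exists>U. open U \<and> w \<in> U \<and> smooth_on U \<sigma>" by blast
  qed
  have sec: "nz_section V (in_chart c \<Lambda>) \<sigma>"
    using oV smooth \<sigma>(3) line by (auto simp: nz_section_def span_base)
  show ?thesis
    unfolding V_def[symmetric] \<sigma>_def[symmetric]
  proof
    fix w X Y assume w: "w \<in> V"
    show "dd X \<sigma> w \<notin> span {\<sigma> w}" if "X \<noteq> 0"
      using im sec w that line[OF w] unfolding immersive_def by blast
    show "lform (dd (\<i> * X) \<sigma> w) (dd (\<i> * Y) \<sigma> w) = lform (dd X \<sigma> w) (dd Y \<sigma> w)"
      using co sec w unfolding conformal_coordinate_def induced_metric_def by blast
  qed (use oV smooth \<sigma> line in auto)
qed

section \<open>Gluing the chart computations into a CMC surface\<close>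

theorem theorem8p26:
  fixes M :: "'m topology" and \<A> :: "'m chart set"
    and \<Lambda> :: "'m \<Rightarrow> (real ^ 5) set"
    and v_inf :: "real ^ 5" and H t :: real and l :: complex
    and N :: "'m \<Rightarrow> real ^ 5" and \<phi> :: "'m \<Rightarrow> real ^ 5 ^ 5"
  assumes "v_inf \<noteq> 0"
    and "has_cmc M \<A> \<Lambda> v_inf H"
    and "unit_normal \<A> \<Lambda> v_inf H N"
    and "norm l = 1"
    and "spectral_isomorphism M \<A> \<Lambda> l (q_inf_t \<Lambda> v_inf N H t) \<phi>"
  shows "\<exists>v :: real ^ 5. v \<noteq> 0 \<and>
    (\<forall>c\<in>\<A>. \<forall>w\<in>chart_image c. v_spectral \<Lambda> v_inf N H t l \<phi> c w = cvec v) \<and>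
    cmc_surface_in M \<A> (bundle_image \<phi> \<Lambda>) v"
proof -
  have surf: "conformal_surface M \<A> \<Lambda>"
    and sf: "\<And>p. p \<in> topspace M \<Longrightarrow> sigma_inf \<Lambda> v_inf p \<in> space_form v_inf"
    using assms(2) by (auto simp: has_cmc_def)
  have M: "oriented_surface M \<A>"
    and not_sphere: "\<And>n. lform n n > 0 \<Longrightarrow> \<exists>p\<in>topspace M. \<exists>x\<in>\<Lambda> p. lform x n \<noteq> 0"
    using surf by (auto simp: conformal_surface_def)
  have ch: "\<And>c. c \<in> \<A> \<Longrightarrow> is_chart M c"
    and ne: "topspace M \<noteq> {}"
    using M by (auto simp: oriented_surface_def)
  define \<sigma> where "\<sigma> = sigma_inf \<Lambda> v_inf"
  define m where "m = Re l * H - t * Im l"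
  have spec: "spectral_deformation (chart_image c) (in_chart c \<Lambda>) (in_chart c \<sigma>) v_inf (in_chart c N)
      H t l (q_inf_t \<Lambda> v_inf N H t c) (in_chart c \<phi>)" if c: "c \<in> \<A>" for c
  proof -
    interpret normalized_lift "chart_image c" "in_chart c \<Lambda>" "in_chart c \<sigma>" v_inf
      unfolding \<sigma>_def by (rule normalized_lift_in_chart[OF surf sf c])
    have N: "smooth_on (chart_image c) (in_chart c N)"
      "\<And>w. w \<in> chart_image c \<Longrightarrow> cvec (in_chart c N w) \<in> perp (csc (in_chart c \<Lambda>) w)"
      "\<And>w. w \<in> chart_image c \<Longrightarrow> lform (in_chart c N w) (in_chart c N w) = 1"
      "\<And>w. w \<in> chart_image c \<Longrightarrow>
        vperp (in_chart c \<Lambda>) v_inf w = complex_of_real H *s cvec (in_chart c N w)"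
      using assms(3) c by (auto simp: unit_normal_def smooth_map_def)
    interpret framed_lift "chart_image c" "in_chart c \<Lambda>" "in_chart c \<sigma>" v_inf "in_chart c N"
      by (rule framed_lift_of_perp_csc) (use N in auto)
    show ?thesis
    proof
      fix w X g assume w: "w \<in> chart_image c"
      show "lform v_inf (in_chart c N w) = H"
      proof -
        have "lform (vperp (in_chart c \<Lambda>) v_inf w) (cvec (in_chart c N w)) =
            complex_of_real (lform v_inf (in_chart c N w))"
          by (simp add: vperp_def oproj_csc[OF w] lform_simps lform_cvec N_unit[OF w])
        then show ?thesis
          by (simp add: N(4)[OF w] lform_simps lform_cvec N_unit[OF w])
      qed
      show "q_inf_t \<Lambda> v_inf N H t c X (\<lambda>u. cvec (g u)) w = cvec ((1 / 2) *\<^sub>R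
        (lform (g w) (in_chart c \<sigma> w) *\<^sub>R
            (H *\<^sub>R dd X (in_chart c N) w - t *\<^sub>R dd (\<i> * X) (in_chart c N) w)
          - lform (g w) (H *\<^sub>R dd X (in_chart c N) w - t *\<^sub>R dd (\<i> * X) (in_chart c N) w)
            *\<^sub>R in_chart c \<sigma> w))"
        unfolding q_inf_t_def q_inf_def star_def eta_inf_def wedge_def \<sigma>_def[symmetric]
          dd_cvec[OF N_differentiable[OF w]] lform_cvec cvec_scaleR cvec_diff
        by (simp add: vec_eq_iff lform_simps field_simps)
    next
      fix w assume w: "w \<in> chart_image c"
      show "is_isometry (in_chart c \<phi> w)"
        using assms(5) inv_chart_in_topspace[OF ch[OF c] w]
        by (simp add: spectral_isomorphism_def in_chart_def)
    qed (use assms(4,5) c in \<open>auto simp: spectral_isomorphism_def smooth_map_def\<close>)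
  qed
  \<comment> \<open>Defined on the surface and not chart by chart, so that connectedness gives one
    vector \<open>v\<close> for all charts.\<close>
  define F where "F p = \<phi> p *v (v_inf + (m - H) *\<^sub>R N p)" for p
  have F: "in_chart c F = (\<lambda>w. in_chart c \<phi> w *v (v_inf + (m - H) *\<^sub>R in_chart c N w))" for c
    by (simp add: F_def in_chart_def fun_eq_iff)
  have "\<exists>v. \<forall>p\<in>topspace M. F p = v"
  proof (rule oriented_surface_constant[OF M])
    fix c w X assume c: "c \<in> \<A>" and w: "w \<in> chart_image c"
    interpret spectral_deformation "chart_image c" "in_chart c \<Lambda>" "in_chart c \<sigma>" v_inf "in_chart c N"
      H t l "q_inf_t \<Lambda> v_inf N H t c" "in_chart c \<phi>" by (rule spec[OF c])
    show "in_chart c F differentiable (at w)"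
      using smooth_on_differentiable[OF smooth_\<phi>_image[OF smooth_v_shift] open_V w]
      by (simp add: F v_shift_def \<mu>_def m_def)
    show "dd X (in_chart c F) w = 0"
      using dd_\<phi>_v_shift[OF w, of X] by (simp add: F v_shift_def \<mu>_def m_def)
  qed
  then obtain v where v: "\<And>p. p \<in> topspace M \<Longrightarrow> F p = v" by blast
  have F_chart: "in_chart c F w = v" if "c \<in> \<A>" "w \<in> chart_image c" for c w
    using v[OF inv_chart_in_topspace[OF ch[OF that(1)] that(2)]] by (simp add: in_chart_def)
  have image_chart: "in_chart c (bundle_image \<phi> \<Lambda>) =
      (\<lambda>w. (\<lambda>x. in_chart c \<phi> w *v x) ` in_chart c \<Lambda> w)" for c
    by (simp add: in_chart_def bundle_image_def fun_eq_iff)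
  have hat: "framed_lift (chart_image c) (in_chart c (bundle_image \<phi> \<Lambda>))
      (\<lambda>w. in_chart c \<phi> w *v in_chart c \<sigma> w) v (\<lambda>w. in_chart c \<phi> w *v in_chart c N w)"
    if c: "c \<in> \<A>" for c
  proof -
    interpret spectral_deformation "chart_image c" "in_chart c \<Lambda>" "in_chart c \<sigma>" v_inf "in_chart c N"
      H t l "q_inf_t \<Lambda> v_inf N H t c" "in_chart c \<phi>" by (rule spec[OF c])
    show ?thesis
      unfolding image_chart
      by (rule framed_lift_\<phi>) (use F_chart[OF c] in \<open>simp add: F v_shift_def \<mu>_def m_def\<close>)
  qed
  have lift: "bundle_image \<phi> \<Lambda> p = span {\<phi> p *v \<sigma> p}" "lform (\<phi> p *v \<sigma> p) v = - 1"
    "lform (\<phi> p *v \<sigma> p) (\<phi> p *v \<sigma> p) = 0" "\<Lambda> p = span {\<sigma> p}"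
    if "p \<in> topspace M" for p
  proof -
    obtain c where c: "c \<in> \<A>" "p \<in> fst c"
      using oriented_surface_chart[OF M \<open>p \<in> topspace M\<close>] by metis
    note w = in_chart_apply[OF ch[OF c(1)] c(2)]
    interpret L: normalized_lift "chart_image c" "in_chart c \<Lambda>" "in_chart c \<sigma>" v_inf
      unfolding \<sigma>_def by (rule normalized_lift_in_chart[OF surf sf c(1)])
    interpret framed_lift "chart_image c" "in_chart c (bundle_image \<phi> \<Lambda>)"
      "\<lambda>w. in_chart c \<phi> w *v in_chart c \<sigma> w" v "\<lambda>w. in_chart c \<phi> w *v in_chart c N w"
      by (rule hat[OF c(1)])
    show "bundle_image \<phi> \<Lambda> p = span {\<phi> p *v \<sigma> p}" "lform (\<phi> p *v \<sigma> p) v = - 1"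
      "lform (\<phi> p *v \<sigma> p) (\<phi> p *v \<sigma> p) = 0" "\<Lambda> p = span {\<sigma> p}"
      using line[OF w(1)] normalized[OF w(1)] null[OF w(1)] L.line[OF w(1)] by (simp_all add: w(2))
  qed
  have lift0: "\<phi> p *v \<sigma> p \<noteq> 0" if "p \<in> topspace M" for p
    using lift(2)[OF that] by (auto simp: lform_simps)
  obtain p0 where p0: "p0 \<in> topspace M" using ne by blast
  \<comment> \<open>The zero vector could not have product \<open>- 1\<close> with the deformed
    lift.\<close>
  then have "v \<noteq> 0"
    using lift(2)[of p0] by (auto simp: lform_simps)
  moreover have "v_spectral \<Lambda> v_inf N H t l \<phi> c w = cvec v"
    if c: "c \<in> \<A>" and w: "w \<in> chart_image c" for c w
  proof -
    interpret spectral_deformation "chart_image c" "in_chart c \<Lambda>" "in_chart c \<sigma>" v_inf "in_chart c N"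
      H t l "q_inf_t \<Lambda> v_inf N H t c" "in_chart c \<phi>" by (rule spec[OF c])
    have "1 / l = cnj l" using norm_l by (simp add: divide_conv_cnj)
    then have "complex_of_real (Re l * H) + \<i> * complex_of_real t / 2 * (l - 1 / l) = complex_of_real m"
      by (simp add: m_def complex_eq_iff)
    moreover have "vtan (in_chart c \<Lambda>) v_inf w = cvec (v_inf - H *\<^sub>R in_chart c N w)"
      by (simp add: vtan_def oproj_csc[OF w] lform_cvec mean[OF w] cvec_diff cvec_scaleR)
    ultimately have "v_spectral \<Lambda> v_inf N H t l \<phi> c w =
        cvec (in_chart c \<phi> w *v (v_inf - H *\<^sub>R in_chart c N w + m *\<^sub>R in_chart c N w))"
      by (simp only: v_spectral_def cvec_add[symmetric] cvec_scaleR[symmetric] cmat_cvec)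
    also have "v_inf - H *\<^sub>R in_chart c N w + m *\<^sub>R in_chart c N w = v_inf + (m - H) *\<^sub>R in_chart c N w"
      by (simp add: algebra_simps)
    finally show ?thesis using F_chart[OF c w] by (simp add: F)
  qed
  \<comment> \<open>The product of \<open>v\<close> with the normal \<open>\<phi>N\<close> is
    \<open>m\<close>, of either sign; \<open>mean_curvature\<close> is a square root, hence the
    absolute value.\<close>
  moreover have "has_cmc M \<A> (bundle_image \<phi> \<Lambda>) v \<bar>m\<bar>"
    unfolding has_cmc_def conformal_surface_def
  proof (intro conjI ballI notI)
    show "oriented_surface M \<A>" by (rule M)
  next
    fix c assume c: "c \<in> \<A>"
    interpret framed_lift "chart_image c" "in_chart c (bundle_image \<phi> \<Lambda>)"
      "\<lambda>w. in_chart c \<phi> w *v in_chart c \<sigma> w" v "\<lambda>w. in_chart c \<phi> w *v in_chart c N w"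
      by (rule hat[OF c])
    show "null_line_subbundle (chart_image c) (in_chart c (bundle_image \<phi> \<Lambda>))"
      "immersive (chart_image c) (in_chart c (bundle_image \<phi> \<Lambda>))"
      "conformal_coordinate (chart_image c) (in_chart c (bundle_image \<phi> \<Lambda>))"
      by (rule null_line_subbundle_V immersive_V conformal_coordinate_V)+
    fix w assume w: "w \<in> chart_image c"
    interpret S: spectral_deformation "chart_image c" "in_chart c \<Lambda>" "in_chart c \<sigma>" v_inf "in_chart c N"
      H t l "q_inf_t \<Lambda> v_inf N H t c" "in_chart c \<phi>" by (rule spec[OF c])
    have "v = in_chart c \<phi> w *v (v_inf + (m - H) *\<^sub>R in_chart c N w)"
      using F_chart[OF c w] by (simp add: F)
    then have "lform v (in_chart c \<phi> w *v in_chart c N w) = m"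
      using S.\<phi>_lform[OF w] S.mean[OF w] S.N_unit[OF w] by (simp add: lform_simps)
    then show "mean_curvature (in_chart c (bundle_image \<phi> \<Lambda>)) v w = \<bar>m\<bar>"
      by (simp add: mean_curvature_def vperp_def oproj_csc[OF w] lform_cvec lform_simps N_unit[OF w]
          power2_eq_square[symmetric] flip: of_real_mult)
  next
    assume "\<exists>n. 0 < lform n n \<and> (\<forall>p\<in>topspace M. \<forall>x\<in>bundle_image \<phi> \<Lambda> p. lform x n = 0)"
    then obtain n where n: "lform n n > 0" "\<And>p. p \<in> topspace M \<Longrightarrow> lform (\<phi> p *v \<sigma> p) n = 0"
      using lift(1) by (metis span_base singletonI)
    have dN: "in_chart c N differentiable (at w)" "dd X (in_chart c N) w = 0"
      if c: "c \<in> \<A>" and w: "w \<in> chart_image c" for c w X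
    proof -
      interpret S: spectral_deformation "chart_image c" "in_chart c \<Lambda>" "in_chart c \<sigma>" v_inf
        "in_chart c N" H t l "q_inf_t \<Lambda> v_inf N H t c" "in_chart c \<phi>" by (rule spec[OF c])
      interpret framed_lift "chart_image c" "in_chart c (bundle_image \<phi> \<Lambda>)"
        "\<lambda>w. in_chart c \<phi> w *v in_chart c \<sigma> w" v "\<lambda>w. in_chart c \<phi> w *v in_chart c N w"
        by (rule hat[OF c])
      show "in_chart c N differentiable (at w)" by (rule S.N_differentiable[OF w])
      have on: "lform (in_chart c \<phi> w *v in_chart c \<sigma> w) n = 0" if "w \<in> chart_image c" for w
        using n(2)[OF inv_chart_in_topspace[OF ch[OF c] that]] by (simp add: in_chart_def)
      \<comment> \<open>The direction \<open>l * X\<close> undoes the rotation by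
        \<open>cnj l\<close>.\<close>
      have "in_chart c \<phi> w *v dd (cnj l * (l * X)) (in_chart c N) w = 0"
        using dN_zero_of_sphere[of n w "l * X"] on n(1) w by (simp add: S.dd_\<phi>_N[OF w])
      moreover have "cnj l * l = 1"
        using assms(4) by (simp add: mult.commute[of "cnj l" l] complex_norm_square[symmetric])
      then have "cnj l * (l * X) = X" by (simp only: mult.assoc[symmetric] mult_1_left)
      ultimately show "dd X (in_chart c N) w = 0"
        using S.\<phi>_eq_0[OF w] by simp
    qed
    obtain k where k: "\<And>p. p \<in> topspace M \<Longrightarrow> N p = k"
      using oriented_surface_constant[OF M dN] by metis
    have N: "lform (N p) (N p) = 1" "lform (\<sigma> p) (N p) = 0" if p: "p \<in> topspace M" for p
    proof -
      obtain c where c: "c \<in> \<A>" "p \<in> fst c"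
        using oriented_surface_chart[OF M p] by metis
      note w = in_chart_apply[OF ch[OF c(1)] c(2)]
      interpret S: spectral_deformation "chart_image c" "in_chart c \<Lambda>" "in_chart c \<sigma>" v_inf
        "in_chart c N" H t l "q_inf_t \<Lambda> v_inf N H t c" "in_chart c \<phi>" by (rule spec[OF c(1)])
      show "lform (N p) (N p) = 1" "lform (\<sigma> p) (N p) = 0"
        using S.N_unit[OF w(1)] S.N_lift[OF w(1)] by (simp_all add: w(2) lform_sym[of "\<sigma> p" "N p"])
    qed
    \<comment> \<open>The constant normal \<open>k\<close> is spacelike and orthogonal to all of
      \<open>\<Lambda>\<close>, which \<open>not_sphere\<close> excludes.\<close>
    have "lform k k > 0" using N(1)[OF p0] k[OF p0] by simp
    from not_sphere[OF this] obtain p x where p: "p \<in> topspace M" "x \<in> \<Lambda> p" "lform x k \<noteq> 0"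
      by (elim bexE) (rule that)
    then obtain r where "x = r *\<^sub>R \<sigma> p" using lift(4)[OF p(1)] by (auto simp: span_singleton)
    then show False using p(3) N(2)[OF p(1)] k[OF p(1)] by (simp add: lform_simps)
  next
    fix p assume p: "p \<in> topspace M"
    show "sigma_inf (bundle_image \<phi> \<Lambda>) v p \<in> space_form v"
      using sigma_inf_span[of "bundle_image \<phi> \<Lambda>" p "\<phi> p *v \<sigma> p" v] lift[OF p] lift0[OF p]
      by (simp add: space_form_def lightcone_def)
  qed
  ultimately show ?thesis unfolding cmc_surface_in_def by blast
qed

end
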